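(* Let $A$ be a PBW-reduction-algebra over a field $\mathbb{K}$, $E$ a finite set, $(A^E,\prec^E)=(\mathbb{K}\langle \underline x\rangle,S_e,I_e,\prec_e)_{e\in E}$ and $G\subseteq A^E$ a finite set. Then $G$ is a (left) Gröbner basis, with respect to $\prec^E$, of the left $A$-submodule of $A^E$ generated by $G$ if and only if both of the following hold: 1. for all nonzero $g,g'\in G$ some (equivalently, any) normal form of $\operatorname{spoly}(g,g')$ with respect to $G$ is $0$, and 2. for all nonzero $g\in G$ and all $p\in I_{\operatorname{lcomp}(g)}$ some (equivalently, any) normal form of $\operatorname{spoly}(g,p)$ with respect to $G$ is $0$.
   Context: **Orderings.** $\mathbb{K}$ is a field, $\mathbb{K}\langle\underline x\rangle=\mathbb{K}\langle x_1,\dots,x_n\rangle$ the free associative algebra, and $\mathbb{K}[\underline x]$ is viewed as the $\mathbb{K}$-subspace of $\mathbb{K}\langle\underline x\rangle$ spanned by the standard monomials $\underline x^\alpha=x_1^{\alpha_1}\cdots x_n^{\alpha_n}$, $\alpha\in\mathbb{N}^n$. For a finite set $E$ and a ring $R$, $R^E=\bigoplus_{e\in E}R(e)$ is the free left module with basis symbols $(e)$; $\operatorname{SMon}(\mathbb{K}\langle\underline x\rangle^E)=\{\underline x^\alpha(e)\}$. A monomial ordering on $\operatorname{SMon}(\mathbb{K}\langle\underline x\rangle^E)$ is a total order such that $\underline x^\alpha(e)\prec\underline x^{\alpha'}(e')$ implies $\underline x^{\alpha+\gamma}(e)\prec\underline x^{\alpha'+\gamma}(e')$ for all $\gamma\in\mathbb{N}^n$;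 it is a well-ordering if moreover $(e)\preceq\underline x^\alpha(e)$ always. We also write $\prec$ for the induced order on $\mathbb{N}^n\times E$. For $|E|=1$ one omits $E$. An ordering $\prec^E$ induces for $e\in E$ the ordering $\prec^E_e$ on $\operatorname{SMon}(\mathbb{K}\langle\underline x\rangle)$: $\underline x^\alpha\prec^E_e\underline x^\beta$ iff $\underline x^\alpha(e)\prec^E\underline x^\beta(e)$. For nonzero $t\in\mathbb{K}[\underline x]^E$ with largest monomial $\underline x^{\alpha}(e)$ having coefficient $c$: $\operatorname{lm}(t)=\underline x^\alpha(e)$, $\operatorname{lc}(t)=c$, $\operatorname{lcomp}(t)=e$, $\operatorname{le}(t)=\alpha$, $\operatorname{lec}(t)=(\alpha,e)$. For $\beta\in\mathbb N^n$, $\beta+(\alpha,e):=(\alpha+\beta,e)$. The leading exponents of $0$ are by convention smaller than all others and unchanged by adding exponents (so conditions on terms with a zero factor are void). **PBW-reduction-algebras.** A commutation system $(S,\prec)$ consists of a monomial ordering $\prec$ on $\operatorname{SMon}(\mathbb{K}\langle\underline x\rangle)$ and a set $S=\{x_jx_i-c_{ij}x_ix_j-d_{ij}\mid 1\le i<j\le n\}$ with $c_{ij}\in\mathbb{K}^*$, $d_{ij}\in\mathbb{K}[\underline x]$, $d_{ij}=0$ or $\operatorname{lm}(d_{ij})\prec x_ix_j$, such that every element of $\mathbb{K}\langle\underline x\rangle$ can be transformed into an element of $\mathbb{K}[\underline x]$ by finitely many $\mathbb{K}$-linear reductions, each replacing one monomial $m\,x_jx_i\,m'$ by $m(c_{ij}x_ix_j+d_{ij})m'$.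 For $G\subseteq\mathbb{K}[\underline x]$ let $\operatorname{l}_\prec(G)=\{\operatorname{le}(g)\mid 0\ne g\in G\}$ and $\operatorname{L}_\prec(G)=\operatorname{l}_\prec(G)+\mathbb{N}^n$. A PBW-reduction datum $(\mathbb{K}\langle\underline x\rangle,S,I,\prec)$ consists of a commutation system $(S,\prec)$ with $\prec$ a well-ordering and a finite set $I\subseteq\mathbb{K}[\underline x]$ with $\operatorname{L}_\prec(I)=\operatorname{l}_\prec(\langle I\cup S\rangle\cap\mathbb{K}[\underline x])$, where $\langle\cdot\rangle$ is the two-sided ideal; the algebra $\mathbb{K}\langle\underline x\rangle/\langle I\cup S\rangle$ is called a PBW-reduction-algebra. The standard monomials $\underline x^\alpha$ with $\alpha\notin \operatorname{L}_\prec(I)$ are called irreducible; their classes form a $\mathbb{K}$-basis of the algebra. **Modules.** $(A^E,\prec^E)=(\mathbb{K}\langle\underline x\rangle,S_e,I_e,\prec_e)_{e\in E}$ means: for each $e$, $(\mathbb{K}\langle\underline x\rangle,S_e,I_e,\prec_e)$ is a PBW-reduction datum with $A=\mathbb{K}\langle\underline x\rangle/\langle I_e\cup S_e\rangle$, $\prec^E$ is a monomial ordering on $\operatorname{SMon}(\mathbb{K}\langle\underline x\rangle^E)$ and $\prec^E_e=\prec_e$. A monomial $\underline x^\alpha(e)$ is irreducible if $\alpha\notin\operatorname{L}_{\prec_e}(I_e)$. Each $a\in A^E$ has a unique representative $\tau(a)\in\mathbb{K}[\underline x]^E$ that is a $\mathbb{K}$-combination of irreducible monomials; $\operatorname{lm}(a),\operatorname{lc}(a),\operatorname{lcomp}(a),\operatorname{le}(a),\operatorname{lec}(a)$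 are those of $\tau(a)$ with respect to $\prec^E$. For $a\in A$, $\operatorname{le}_{\prec^E_e}(a)$ is defined likewise using $(\mathbb{K}\langle\underline x\rangle,S_e,I_e,\prec_e)$. For $G\subseteq A^E$, $\operatorname{L}_{\prec^E}(G)=\{\beta+\operatorname{lec}(g)\mid 0\ne g\in G,\beta\in\mathbb{N}^n\}$. **Gröbner basis.** A finite subset $G$ of an $A$-submodule $M\subseteq A^E$ is a Gröbner basis of $M$ if every $m\in M$ can be written $m=\sum_{g\in G}a_gg$ with $a_g\in A$ and $\operatorname{le}_{\prec^E_{\operatorname{lcomp}(g)}}(a_g)+\operatorname{lec}(g)\preceq^E\operatorname{lec}(m)$ for all $g\in G$. **Normal form.** $r\in A^E$ is a normal form of $a\ne0$ with respect to finite $G$ if there are $h_g\in A$ with $a=\sum_{g\in G}h_gg+r$, $\operatorname{le}_{\prec^E_{\operatorname{lcomp}(g)}}(h_g)+\operatorname{lec}(g)\preceq^E\operatorname{lec}(a)$ for all $g$, and $\operatorname{lec}(r)\notin\operatorname{L}_{\prec^E}(G)$ if $r\neq0$. The normal form of $0$ is $0$. **s-polynomials.** For nonzero $a,a'\in A^E$ with $\operatorname{lcomp}(a)=\operatorname{lcomp}(a')=e$ let $b_i=\max\{\operatorname{le}(a)_i,\operatorname{le}(a')_i\}$, $c_{a,a'}=b-\operatorname{le}(a)$, $c_{a',a}=b-\operatorname{le}(a')$. If $\underline x^{b}(e)$ is irreducible, $\operatorname{spoly}(a,a')=\frac{1}{\operatorname{lc}(\underline x^{c_{a,a'}}a)}\underline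 x^{c_{a,a'}}a-\frac{1}{\operatorname{lc}(\underline x^{c_{a',a}}a')}\underline x^{c_{a',a}}a'$; otherwise $\operatorname{spoly}(a,a')=0$. If $\operatorname{lcomp}(a)\neq\operatorname{lcomp}(a')$, $\operatorname{spoly}(a,a')=0$. For nonzero $a\in A^E$ with $e=\operatorname{lcomp}(a)$ and $p\in I_e$, $\operatorname{spoly}(a,p)=\underline x^{c}a$ with $c_i=\max\{\operatorname{le}(a)_i,\operatorname{le}_{\prec_e}(p)_i\}-\operatorname{le}(a)_i$ (for $p=0$ put $\operatorname{spoly}(a,p)=0$). *)

theory Defs
  imports "HOL-Library.Poly_Mapping" "HOL-Library.Function_Algebras"
    "HOL-Algebra.QuotRing" "HOL-Algebra.Module"
begin

section \<open>The free associative algebra\<close>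

text \<open>Lists under concatenation form the free monoid, so the convolution product of
  \<^theory>\<open>HOL-Library.Poly_Mapping\<close> makes \<open>'n list \<Rightarrow>\<^sub>0 'k\<close> the free associative algebra over
  \<open>'k\<close>.  The variables are indexed by a finite linearly ordered type \<open>'n\<close>, whose order is
  the order \<open>x\<^sub>1, \<dots>, x\<^sub>n\<close>.\<close>

instantiation list :: (type) monoid_add
begin

definition zero_list :: "'a list" where "zero_list = []"

definition plus_list :: "'a list \<Rightarrow> 'a list \<Rightarrow> 'a list" where "plus_list = append"

instance by standard (simp_all add: zero_list_def plus_list_def)

end

type_synonym ('n, 'k) fpoly = "'n list \<Rightarrow>\<^sub>0 'k"
type_synonym 'n expo = "'n \<Rightarrow> nat"

definition free_algebra :: "('n, 'k::field) fpoly ring" where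
  "free_algebra = \<lparr>carrier = UNIV, mult = (*), one = 1, zero = 0, add = (+)\<rparr>"

definition std_word :: "('n::{finite,linorder}) expo \<Rightarrow> 'n list" where
  "std_word \<alpha> = concat (map (\<lambda>i. replicate (\<alpha> i) i) (sorted_list_of_set UNIV))"

definition var_expo :: "'n \<Rightarrow> 'n expo" where
  "var_expo i = (\<lambda>k. if k = i then 1 else 0)"

text \<open>The subspace \<open>\<K>[x]\<close> spanned by the standard monomials.\<close>

definition std_polys :: "('n::{finite,linorder}, 'k::field) fpoly set" where
  "std_polys = {f. Poly_Mapping.keys f \<subseteq> range std_word}"

definition expos :: "('n::{finite,linorder}, 'k::field) fpoly \<Rightarrow> 'n expo set" where
  "expos f = {\<alpha>. Poly_Mapping.lookup f (std_word \<alpha>) \<noteq> 0}"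

section \<open>Monomial orderings\<close>

text \<open>Orderings are given as reflexive relations on exponents; the strict order is
  \<open>r - Id\<close>.\<close>

definition monomial_ordering :: "'n expo rel \<Rightarrow> bool" where
  "monomial_ordering r \<longleftrightarrow> linear_order_on UNIV r \<and>
     (\<forall>\<alpha> \<beta> \<gamma>. (\<alpha>, \<beta>) \<in> r - Id \<longrightarrow> (\<alpha> + \<gamma>, \<beta> + \<gamma>) \<in> r - Id)"

definition well_ordering :: "'n expo rel \<Rightarrow> bool" where
  "well_ordering r \<longleftrightarrow> (\<forall>\<alpha>. (0, \<alpha>) \<in> r)"

definition module_monomial_ordering :: "'e set \<Rightarrow> ('n expo \<times> 'e) rel \<Rightarrow> bool" where
  "module_monomial_ordering E r \<longleftrightarrow> linear_order_on (UNIV \<times> E) r \<and>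
     (\<forall>\<alpha> e \<beta> e' \<gamma>. ((\<alpha>, e), (\<beta>, e')) \<in> r - Id \<longrightarrow> ((\<alpha> + \<gamma>, e), (\<beta> + \<gamma>, e')) \<in> r - Id)"

definition induced_ordering :: "('n expo \<times> 'e) rel \<Rightarrow> 'e \<Rightarrow> 'n expo rel" where
  "induced_ordering r e = {(\<alpha>, \<beta>). ((\<alpha>, e), (\<beta>, e)) \<in> r}"

definition largest :: "'a rel \<Rightarrow> 'a set \<Rightarrow> 'a" where
  "largest r X = (THE m. m \<in> X \<and> (\<forall>x\<in>X. (x, m) \<in> r))"

text \<open>Leading exponents; meaningful for nonzero arguments only.\<close>

definition le_poly :: "('n::{finite,linorder}) expo rel \<Rightarrow> ('n, 'k::field) fpoly \<Rightarrow> 'n expo" where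
  "le_poly r f = largest r (expos f)"

definition l_set :: "('n::{finite,linorder}) expo rel \<Rightarrow> ('n, 'k::field) fpoly set \<Rightarrow> 'n expo set" where
  "l_set r G = {le_poly r g | g. g \<in> G \<and> g \<noteq> 0}"

definition L_set :: "('n::{finite,linorder}) expo rel \<Rightarrow> ('n, 'k::field) fpoly set \<Rightarrow> 'n expo set" where
  "L_set r G = {\<alpha> + \<gamma> | \<alpha> \<gamma>. \<alpha> \<in> l_set r G}"

section \<open>PBW-reduction-algebras\<close>

text \<open>Replace the monomial \<open>m x\<^sub>j x\<^sub>i m'\<close> in \<open>f\<close> by \<open>m (c\<^sub>i\<^sub>j x\<^sub>i x\<^sub>j + d\<^sub>i\<^sub>j) m'\<close>.\<close>

definition reduction_step ::
  "('n::linorder \<Rightarrow> 'n \<Rightarrow> 'k::field) \<Rightarrow> ('n \<Rightarrow> 'n \<Rightarrow> ('n, 'k) fpoly) \<Rightarrow>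
   ('n, 'k) fpoly \<Rightarrow> ('n, 'k) fpoly \<Rightarrow> bool" where
  "reduction_step c d f f' \<longleftrightarrow>
     (\<exists>i j m m' a. i < j \<and> a = Poly_Mapping.lookup f (m @ [j, i] @ m') \<and>
        f' = f - Poly_Mapping.single (m @ [j, i] @ m') a
               + Poly_Mapping.single m a * (Poly_Mapping.single [i, j] (c i j) + d i j)
                   * Poly_Mapping.single m' 1)"

definition commutation_system ::
  "('n::{finite,linorder}, 'k::field) fpoly set \<Rightarrow> 'n expo rel \<Rightarrow> bool" where
  "commutation_system S r \<longleftrightarrow> monomial_ordering r \<and>
     (\<exists>c d. S = {Poly_Mapping.single [j, i] 1 - Poly_Mapping.single [i, j] (c i j) - d i j
                  | i j. i < j} \<and>
        (\<forall>i j. i < j \<longrightarrow> c i j \<noteq> 0 \<and> d i j \<in> std_polys \<and>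
           (d i j = 0 \<or> (le_poly r (d i j), var_expo i + var_expo j) \<in> r - Id)) \<and>
        (\<forall>f. \<exists>f'\<in>std_polys. (reduction_step c d)\<^sup>*\<^sup>* f f'))"

definition PBW_ideal :: "('n, 'k::field) fpoly set \<Rightarrow> ('n, 'k) fpoly set \<Rightarrow> ('n, 'k) fpoly set" where
  "PBW_ideal S I = Idl\<^bsub>free_algebra\<^esub> (I \<union> S)"

definition PBW_datum ::
  "('n::{finite,linorder}, 'k::field) fpoly set \<Rightarrow> ('n, 'k) fpoly set \<Rightarrow> 'n expo rel \<Rightarrow> bool" where
  "PBW_datum S I r \<longleftrightarrow> commutation_system S r \<and> well_ordering r \<and> finite I \<and> I \<subseteq> std_polys \<and>
     L_set r I = l_set r (PBW_ideal S I \<inter> std_polys)"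

definition PBW_quotient ::
  "('n, 'k::field) fpoly set \<Rightarrow> ('n, 'k) fpoly set \<Rightarrow> ('n, 'k) fpoly set ring" where
  "PBW_quotient S I = free_algebra Quot PBW_ideal S I"

definition PBW_reduction_algebra :: "('n::{finite,linorder}, 'k::field) fpoly set ring \<Rightarrow> bool" where
  "PBW_reduction_algebra A \<longleftrightarrow> (\<exists>S I r. PBW_datum S I r \<and> A = PBW_quotient S I)"

section \<open>The free module\<close>

text \<open>Only the additive structure and \<open>smult\<close> of the record are meaningful.
  The coefficients are noncommutative, so this is not an instance of the library's
  \<^locale>\<open>module\<close>, but \<^locale>\<open>submodule\<close> does not require that.\<close>

definition free_module :: "('a, 'b) ring_scheme \<Rightarrow> 'e set \<Rightarrow> ('a, 'e \<Rightarrow> 'a) module" where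
  "free_module A E =
     \<lparr>carrier = E \<rightarrow>\<^sub>E carrier A, mult = undefined, one = undefined,
      zero = (\<lambda>e\<in>E. \<zero>\<^bsub>A\<^esub>), add = (\<lambda>u v. \<lambda>e\<in>E. u e \<oplus>\<^bsub>A\<^esub> v e),
      smult = (\<lambda>a u. \<lambda>e\<in>E. a \<otimes>\<^bsub>A\<^esub> u e)\<rparr>"

definition generated_submodule ::
  "('a, 'b) ring_scheme \<Rightarrow> ('a, 'm, 'c) module_scheme \<Rightarrow> 'm set \<Rightarrow> 'm set" where
  "generated_submodule A M G = \<Inter>{N. submodule N A M \<and> G \<subseteq> N}"

definition PBW_module ::
  "('n::{finite,linorder}, 'k::field) fpoly set ring \<Rightarrow> 'e set \<Rightarrow> ('n expo \<times> 'e) rel \<Rightarrow>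
   ('e \<Rightarrow> ('n, 'k) fpoly set) \<Rightarrow> ('e \<Rightarrow> ('n, 'k) fpoly set) \<Rightarrow> ('e \<Rightarrow> 'n expo rel) \<Rightarrow> bool" where
  "PBW_module A E rE S I r \<longleftrightarrow> module_monomial_ordering E rE \<and>
     (\<forall>e\<in>E. PBW_datum (S e) (I e) (r e) \<and> A = PBW_quotient (S e) (I e) \<and>
             induced_ordering rE e = r e)"

text \<open>Elements of the quotient algebra are cosets, so a representative is an element of the coset.\<close>

definition rep_alg ::
  "('n::{finite,linorder}) expo rel \<Rightarrow> ('n, 'k::field) fpoly set \<Rightarrow> ('n, 'k) fpoly set \<Rightarrow>
   ('n, 'k) fpoly" where
  "rep_alg r I a = (THE t. t \<in> std_polys \<and> expos t \<inter> L_set r I = {} \<and> t \<in> a)"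

definition le_alg ::
  "('n::{finite,linorder}) expo rel \<Rightarrow> ('n, 'k::field) fpoly set \<Rightarrow> ('n, 'k) fpoly set \<Rightarrow> 'n expo" where
  "le_alg r I a = le_poly r (rep_alg r I a)"

definition rep ::
  "'e set \<Rightarrow> (('n::{finite,linorder}) expo \<times> 'e) rel \<Rightarrow> ('e \<Rightarrow> ('n, 'k::field) fpoly set) \<Rightarrow>
   ('e \<Rightarrow> ('n, 'k) fpoly set) \<Rightarrow> 'e \<Rightarrow> ('n, 'k) fpoly" where
  "rep E rE I a = (\<lambda>e\<in>E. rep_alg (induced_ordering rE e) (I e) (a e))"

definition lec ::
  "'e set \<Rightarrow> (('n::{finite,linorder}) expo \<times> 'e) rel \<Rightarrow> ('e \<Rightarrow> ('n, 'k::field) fpoly set) \<Rightarrow>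
   ('e \<Rightarrow> ('n, 'k) fpoly set) \<Rightarrow> 'n expo \<times> 'e" where
  "lec E rE I a = largest rE {(\<alpha>, e). e \<in> E \<and> \<alpha> \<in> expos (rep E rE I a e)}"

definition le ::
  "'e set \<Rightarrow> (('n::{finite,linorder}) expo \<times> 'e) rel \<Rightarrow> ('e \<Rightarrow> ('n, 'k::field) fpoly set) \<Rightarrow>
   ('e \<Rightarrow> ('n, 'k) fpoly set) \<Rightarrow> 'n expo" where
  "le E rE I a = fst (lec E rE I a)"

definition lcomp ::
  "'e set \<Rightarrow> (('n::{finite,linorder}) expo \<times> 'e) rel \<Rightarrow> ('e \<Rightarrow> ('n, 'k::field) fpoly set) \<Rightarrow>
   ('e \<Rightarrow> ('n, 'k) fpoly set) \<Rightarrow> 'e" where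
  "lcomp E rE I a = snd (lec E rE I a)"

definition lc ::
  "'e set \<Rightarrow> (('n::{finite,linorder}) expo \<times> 'e) rel \<Rightarrow> ('e \<Rightarrow> ('n, 'k::field) fpoly set) \<Rightarrow>
   ('e \<Rightarrow> ('n, 'k) fpoly set) \<Rightarrow> 'k" where
  "lc E rE I a = Poly_Mapping.lookup (rep E rE I a (lcomp E rE I a)) (std_word (le E rE I a))"

definition shift :: "'n expo \<Rightarrow> 'n expo \<times> 'e \<Rightarrow> 'n expo \<times> 'e" where
  "shift \<beta> p = (fst p + \<beta>, snd p)"

definition L_module ::
  "('n::{finite,linorder}, 'k::field) fpoly set ring \<Rightarrow> 'e set \<Rightarrow> ('n expo \<times> 'e) rel \<Rightarrow>
   ('e \<Rightarrow> ('n, 'k) fpoly set) \<Rightarrow> ('e \<Rightarrow> ('n, 'k) fpoly set) set \<Rightarrow> ('n expo \<times> 'e) set" where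
  "L_module A E rE I G =
     {shift \<beta> (lec E rE I g) | \<beta> g. g \<in> G \<and> g \<noteq> \<zero>\<^bsub>free_module A E\<^esub>}"

section \<open>Groebner bases and normal forms\<close>

text \<open>The condition \<open>le(h) + lec(g) \<preceq> lec(a)\<close>, where \<open>le\<close> is taken in the component
  \<open>lcomp(g)\<close>.  The leading exponents of \<open>0\<close> are smaller than all others and absorb
  addition, so the condition is void if \<open>h\<close> or \<open>g\<close> vanishes, and otherwise fails for \<open>a = 0\<close>.\<close>

definition lec_bounded ::
  "('n::{finite,linorder}, 'k::field) fpoly set ring \<Rightarrow> 'e set \<Rightarrow> ('n expo \<times> 'e) rel \<Rightarrow>
   ('e \<Rightarrow> ('n, 'k) fpoly set) \<Rightarrow> ('n, 'k) fpoly set \<Rightarrow> ('e \<Rightarrow> ('n, 'k) fpoly set) \<Rightarrow>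
   ('e \<Rightarrow> ('n, 'k) fpoly set) \<Rightarrow> bool" where
  "lec_bounded A E rE I h g a \<longleftrightarrow>
     h = \<zero>\<^bsub>A\<^esub> \<or> g = \<zero>\<^bsub>free_module A E\<^esub> \<or>
     (a \<noteq> \<zero>\<^bsub>free_module A E\<^esub> \<and>
      (shift (le_alg (induced_ordering rE (lcomp E rE I g)) (I (lcomp E rE I g)) h) (lec E rE I g),
       lec E rE I a) \<in> rE)"

definition groebner_basis ::
  "('n::{finite,linorder}, 'k::field) fpoly set ring \<Rightarrow> 'e set \<Rightarrow> ('n expo \<times> 'e) rel \<Rightarrow>
   ('e \<Rightarrow> ('n, 'k) fpoly set) \<Rightarrow> ('e \<Rightarrow> ('n, 'k) fpoly set) set \<Rightarrow>
   ('e \<Rightarrow> ('n, 'k) fpoly set) set \<Rightarrow> bool" where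
  "groebner_basis A E rE I G N \<longleftrightarrow>
     submodule N A (free_module A E) \<and> finite G \<and> G \<subseteq> N \<and>
     (\<forall>m\<in>N. \<exists>a \<in> G \<rightarrow> carrier A.
        m = (\<Oplus>\<^bsub>free_module A E\<^esub>g\<in>G. a g \<odot>\<^bsub>free_module A E\<^esub> g) \<and>
        (\<forall>g\<in>G. lec_bounded A E rE I (a g) g m))"

definition is_normal_form ::
  "('n::{finite,linorder}, 'k::field) fpoly set ring \<Rightarrow> 'e set \<Rightarrow> ('n expo \<times> 'e) rel \<Rightarrow>
   ('e \<Rightarrow> ('n, 'k) fpoly set) \<Rightarrow> ('e \<Rightarrow> ('n, 'k) fpoly set) set \<Rightarrow>
   ('e \<Rightarrow> ('n, 'k) fpoly set) \<Rightarrow> ('e \<Rightarrow> ('n, 'k) fpoly set) \<Rightarrow> bool" where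
  "is_normal_form A E rE I G a r \<longleftrightarrow>
     (if a = \<zero>\<^bsub>free_module A E\<^esub> then r = \<zero>\<^bsub>free_module A E\<^esub>
      else r \<in> carrier (free_module A E) \<and>
        (\<exists>h \<in> G \<rightarrow> carrier A.
           a = (\<Oplus>\<^bsub>free_module A E\<^esub>g\<in>G. h g \<odot>\<^bsub>free_module A E\<^esub> g) \<oplus>\<^bsub>free_module A E\<^esub> r \<and>
           (\<forall>g\<in>G. lec_bounded A E rE I (h g) g a)) \<and>
        (r \<noteq> \<zero>\<^bsub>free_module A E\<^esub> \<longrightarrow> lec E rE I r \<notin> L_module A E rE I G))"

section \<open>s-polynomials\<close>

text \<open>The class of \<open>f\<close> in \<open>A\<close>; the zero of a quotient ring is the ideal itself.\<close>

definition cls ::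
  "('n, 'k::field) fpoly set ring \<Rightarrow> ('n, 'k) fpoly \<Rightarrow> ('n, 'k) fpoly set" where
  "cls A f = \<zero>\<^bsub>A\<^esub> +>\<^bsub>free_algebra\<^esub> f"

definition mono_mult ::
  "('n::{finite,linorder}, 'k::field) fpoly set ring \<Rightarrow> 'e set \<Rightarrow> 'n expo \<Rightarrow>
   ('e \<Rightarrow> ('n, 'k) fpoly set) \<Rightarrow> 'e \<Rightarrow> ('n, 'k) fpoly set" where
  "mono_mult A E \<gamma> a = cls A (Poly_Mapping.single (std_word \<gamma>) 1) \<odot>\<^bsub>free_module A E\<^esub> a"

definition scalar_mult ::
  "('n::{finite,linorder}, 'k::field) fpoly set ring \<Rightarrow> 'e set \<Rightarrow> 'k \<Rightarrow>
   ('e \<Rightarrow> ('n, 'k) fpoly set) \<Rightarrow> 'e \<Rightarrow> ('n, 'k) fpoly set" where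
  "scalar_mult A E k a = cls A (Poly_Mapping.single [] k) \<odot>\<^bsub>free_module A E\<^esub> a"

text \<open>On exponents, \<open>sup\<close> and \<open>-\<close> are the pointwise maximum and difference.\<close>

definition spoly ::
  "('n::{finite,linorder}, 'k::field) fpoly set ring \<Rightarrow> 'e set \<Rightarrow> ('n expo \<times> 'e) rel \<Rightarrow>
   ('e \<Rightarrow> ('n, 'k) fpoly set) \<Rightarrow> ('e \<Rightarrow> ('n, 'k) fpoly set) \<Rightarrow> ('e \<Rightarrow> ('n, 'k) fpoly set) \<Rightarrow>
   'e \<Rightarrow> ('n, 'k) fpoly set" where
  "spoly A E rE I a a' =
     (let e = lcomp E rE I a;
          b = sup (le E rE I a) (le E rE I a');
          u = mono_mult A E (b - le E rE I a) a;
          u' = mono_mult A E (b - le E rE I a') a'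
      in if lcomp E rE I a' = e \<and> b \<notin> L_set (induced_ordering rE e) (I e)
         then scalar_mult A E (1 / lc E rE I u) u \<ominus>\<^bsub>free_module A E\<^esub>
              scalar_mult A E (1 / lc E rE I u') u'
         else \<zero>\<^bsub>free_module A E\<^esub>)"

definition spoly_rel ::
  "('n::{finite,linorder}, 'k::field) fpoly set ring \<Rightarrow> 'e set \<Rightarrow> ('n expo \<times> 'e) rel \<Rightarrow>
   ('e \<Rightarrow> ('n, 'k) fpoly set) \<Rightarrow> ('e \<Rightarrow> ('n, 'k) fpoly set) \<Rightarrow> ('n, 'k) fpoly \<Rightarrow>
   'e \<Rightarrow> ('n, 'k) fpoly set" where
  "spoly_rel A E rE I a p =
     (if p = 0 then \<zero>\<^bsub>free_module A E\<^esub>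
      else mono_mult A E
        (sup (le E rE I a) (le_poly (induced_ordering rE (lcomp E rE I a)) p) - le E rE I a) a)"

end

theory Submission
  imports Defs Complex_Main "HOL-Library.Infinite_Set"
begin

text \<open>An element of \<open>A\<^sup>E\<close> is a vector of polynomials modulo the two-sided ideal \<open>J\<close> with
\<open>A = K\<langle>x\<rangle>/J\<close>.  The proof is Buchberger's argument for such vectors.  Two observations make it
work although \<open>A\<close> is noncommutative and every component \<open>e\<close> carries relations and an ordering of
its own.

First, a word in which the letter \<open>x\<^sub>i\<close> occurs \<open>\<alpha>\<^sub>i\<close> times is congruent to \<open>c x\<^sup>\<alpha> + f\<close> with
\<open>c \<noteq> 0\<close>, where all words of \<open>f\<close> have smaller letter counts (\<open>commutation_system_word\<close>).  So
exponents add under multiplication up to a nonzero scalar and lower terms, and a leading term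
\<open>x\<^sup>\<alpha>(e)\<close> can only get lost on multiplication by \<open>x\<^sup>\<gamma>\<close> if \<open>\<alpha> + \<gamma>\<close> is reducible in the component
\<open>e\<close> (\<open>lead_left_mult\<close>).

Second, a coefficient \<open>h\<close> of \<open>g\<close> is measured by the ordering of the leading component of \<open>g\<close>,
but a bound on all \<open>content w + lec g\<close>, for the words \<open>w\<close> of \<open>h\<close>, bounds all components of
\<open>h g\<close>, because the orderings of the components are induced by one ordering of the monomials of
the module (\<open>supp_left_mult\<close>).  Hence a standard representation of \<open>u\<close> may be described without
normal forms of the coefficients: \<open>u\<close> is congruent to a sum of \<open>h\<^sub>g g\<close> in which every word of every
\<open>h\<^sub>g\<close> moves \<open>lec g\<close> to a monomial \<open>\<preceq> lec u\<close> (\<open>repr_within\<close>, \<open>standard_representation_iff\<close>).  Sets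
of vectors with a bounded representation are closed under sums, and a left multiplication shifts
the bound.

If \<open>G\<close> is a Groebner basis, a normal form \<open>R\<close> of an element of the submodule lies in the
submodule.  If \<open>R\<close> were nonzero, some term of a standard representation of \<open>R\<close> would reach
\<open>lec R\<close>, so that \<open>lec R\<close> would be a multiple of a leading monomial of \<open>G\<close> (\<open>lead_of_repr\<close>),
contrary to the definition of a normal form.

Conversely, let all s-polynomials have the normal form \<open>0\<close>, hence standard representations, and
let \<open>t\<close> be the least bound of a representation of a nonzero element \<open>u\<close> of the submodule; it
exists by Dickson's lemma.  Suppose that \<open>lec u \<prec> t\<close>.  If \<open>t\<close> is reducible, every term \<open>x\<^sup>\<gamma> g\<close>
with \<open>\<gamma> + lec g = t\<close> is, up to lower terms, a multiple of some \<open>spoly(g, p)\<close>, and a standard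
representation of the latter rewrites the term below \<open>t\<close> (\<open>reducible_monomial\<close>).  If \<open>t\<close> is
irreducible, the s-polynomials of pairs show that any two terms of this kind are proportional
modulo representations below \<open>t\<close> (\<open>proportional_monomials\<close>).  So \<open>u\<close> is a scalar multiple of one
of them, up to something below \<open>t\<close>; that one has the leading monomial \<open>t\<close> and \<open>u\<close> does not, so
the scalar is \<open>0\<close>.  In both cases \<open>u\<close> has a representation below \<open>t\<close>, contrary to the choice of
\<open>t\<close> (\<open>lower_top_term\<close>, \<open>buchberger\<close>).

Finally, normal forms exist by division with remainder (\<open>normal_form_vector_exists\<close>), so that
the condition on all normal forms of the s-polynomials implies the one on some of them.\<close>

section \<open>Well-foundedness of monomial orderings\<close>

lemma nat_seq_mono_subseq:
  fixes f :: "nat \<Rightarrow> nat"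
  shows "\<exists>g :: nat \<Rightarrow> nat. strict_mono g \<and> (\<forall>i j. i \<le> j \<longrightarrow> f (g i) \<le> f (g j))"
proof -
  obtain g :: "nat \<Rightarrow> nat" where g: "strict_mono g" "monoseq (\<lambda>n. f (g n))"
    using seq_monosub[of f] by blast
  show ?thesis
  proof (cases "\<forall>i j. i \<le> j \<longrightarrow> f (g i) \<le> f (g j)")
    case True
    with g(1) have "strict_mono g \<and> (\<forall>i j. i \<le> j \<longrightarrow> f (g i) \<le> f (g j))" by (rule conjI)
    then show ?thesis by blast
  next
    case False
    with g(2) have dec: "\<forall>i j. i \<le> j \<longrightarrow> f (g j) \<le> f (g i)"
      by (auto simp: monoseq_def)
    define m where "m = (LEAST x. x \<in> range (f \<circ> g))"
    have "m \<in> range (f \<circ> g)" unfolding m_def by (rule LeastI_ex) blast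
    then obtain N where N: "m = f (g N)" by auto
    have least: "m \<le> f (g n)" for n unfolding m_def by (rule Least_le) auto
    have eq: "f (g n) = m" if "N \<le> n" for n
      using dec that least[of n] N by (metis antisym)
    have "strict_mono (\<lambda>n. g (N + n))"
      using g(1) by (simp add: strict_mono_def)
    moreover have "\<forall>i j. i \<le> j \<longrightarrow> f (g (N + i)) \<le> f (g (N + j))"
      using eq by simp
    ultimately have "strict_mono (\<lambda>n. g (N + n)) \<and> (\<forall>i j. i \<le> j \<longrightarrow> f (g (N + i)) \<le> f (g (N + j)))"
      by (rule conjI)
    then show ?thesis by blast
  qed
qed

text \<open>Thinning out the sequence once for each of the finitely many coordinates
makes it weakly increasing in all of them.\<close>

lemma dickson:
  fixes a :: "nat \<Rightarrow> 'n::finite \<Rightarrow> nat"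
  shows "\<exists>i j. i < j \<and> a i \<le> a j"
proof -
  have "\<exists>g :: nat \<Rightarrow> nat. strict_mono g \<and> (\<forall>x\<in>X. \<forall>i j. i \<le> j \<longrightarrow> a (g i) x \<le> a (g j) x)" if "finite X" for X :: "'n set"
    using that
  proof (induction X)
    case empty
    show ?case by (rule exI[of _ "\<lambda>x :: nat. x"]) (simp add: strict_mono_def)
  next
    case (insert y X)
    then obtain g :: "nat \<Rightarrow> nat" where g: "strict_mono g" "\<forall>x\<in>X. \<forall>i j. i \<le> j \<longrightarrow> a (g i) x \<le> a (g j) x"
      by blast
    obtain h :: "nat \<Rightarrow> nat" where h: "strict_mono h" "\<forall>i j. i \<le> j \<longrightarrow> a (g (h i)) y \<le> a (g (h j)) y"
      using nat_seq_mono_subseq[of "\<lambda>i. a (g i) y"] by blast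
    have "strict_mono (g \<circ> h)" using g(1) h(1) by (rule strict_mono_o)
    moreover have "\<forall>x\<in>insert y X. \<forall>i j. i \<le> j \<longrightarrow> a ((g \<circ> h) i) x \<le> a ((g \<circ> h) j) x"
      using g(2) h(2) h(1) by (simp add: strict_mono_less_eq)
    ultimately have "strict_mono (g \<circ> h) \<and>
        (\<forall>x\<in>insert y X. \<forall>i j. i \<le> j \<longrightarrow> a ((g \<circ> h) i) x \<le> a ((g \<circ> h) j) x)"
      by (rule conjI)
    then show ?case by blast
  qed
  from this[of UNIV] obtain g :: "nat \<Rightarrow> nat" where g: "strict_mono g" "\<forall>x. \<forall>i j. i \<le> j \<longrightarrow> a (g i) x \<le> a (g j) x"
    by auto
  have "g 0 < g 1" using g(1) by (simp add: strict_mono_def)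
  moreover have "a (g 0) \<le> a (g 1)" using g(2) by (simp add: le_fun_def)
  ultimately show ?thesis by blast
qed

lemma module_ordering_add:
  assumes "module_monomial_ordering E rE" "((\<alpha>, e), (\<beta>, e')) \<in> rE"
  shows "((\<alpha> + \<gamma>, e), (\<beta> + \<gamma>, e')) \<in> rE"
proof (cases "(\<alpha>, e) = (\<beta>, e')")
  case True
  have module_ord_linear: "linear_order_on (UNIV \<times> E) rE" using assms(1) by (simp add: module_monomial_ordering_def)
  then have "refl_on (UNIV \<times> E) rE" "rE \<subseteq> (UNIV \<times> E) \<times> (UNIV \<times> E)"
    by (auto simp: linear_order_on_def partial_order_on_def preorder_on_def)
  then show ?thesis using True assms(2) by (auto simp: refl_on_def)
next
  case False
  then have "((\<alpha>, e), (\<beta>, e')) \<in> rE - Id" using assms(2) by simp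
  then show ?thesis using assms(1) by (auto simp: module_monomial_ordering_def)
qed

lemma expo_le_iff_add: "\<alpha> \<le> \<beta> \<longleftrightarrow> (\<exists>\<gamma>. \<beta> = \<alpha> + \<gamma>)" for \<alpha> \<beta> :: "'n expo"
proof
  assume "\<alpha> \<le> \<beta>"
  then have "\<beta> = \<alpha> + (\<beta> - \<alpha>)" by (auto simp: fun_eq_iff le_fun_def)
  then show "\<exists>\<gamma>. \<beta> = \<alpha> + \<gamma>" by blast
qed (auto simp: le_fun_def)

text \<open>In an infinite descending chain some component occurs infinitely often, and by Dickson's
lemma two of its exponents are comparable in the divisibility order.  Since \<open>(e)\<close> is the least
monomial of its component, the later one would be at least as large as the earlier one.\<close>

lemma wf_module_ordering:
  fixes rE :: "('n::finite expo \<times> 'e) rel"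
  assumes fin: "finite E" and mon: "module_monomial_ordering E rE"
    and least: "\<And>e \<alpha>. e \<in> E \<Longrightarrow> ((0, e), (\<alpha>, e)) \<in> rE"
  shows "wf (rE - Id)"
  unfolding wf_iff_no_infinite_down_chain
proof
  assume "\<exists>f. \<forall>i. (f (Suc i), f i) \<in> rE - Id"
  then obtain f where f: "\<And>i. (f (Suc i), f i) \<in> rE - Id" by blast
  have module_ord_linear: "linear_order_on (UNIV \<times> E) rE" using mon by (simp add: module_monomial_ordering_def)
  then have tr: "trans rE" and anti: "antisym rE" and sub: "rE \<subseteq> (UNIV \<times> E) \<times> (UNIV \<times> E)"
    by (auto simp: linear_order_on_def partial_order_on_def preorder_on_def)
  have tr': "trans (rE - Id)" using tr anti by (rule trans_diff_Id)
  have desc: "(f j, f i) \<in> rE - Id" if "i < j" for i j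
    using that
  proof (induction j)
    case (Suc j)
    then show ?case using f[of j] tr' by (cases "i = j") (auto dest: transD)
  qed simp
  have "snd (f i) \<in> E" for i using f[of i] sub by (cases "f i") auto
  then have "finite (range (snd \<circ> f))" using fin by (auto intro: finite_subset)
  then obtain i0 where inf: "infinite {i. (snd \<circ> f) i = (snd \<circ> f) i0}"
    using pigeonhole_infinite[of UNIV "snd \<circ> f"] by auto
  define e where "e = snd (f i0)"
  obtain h :: "nat \<Rightarrow> nat" where h: "strict_mono h" "\<And>k. snd (f (h k)) = e"
  proof -
    obtain h :: "nat \<Rightarrow> nat" where "strict_mono h" "\<forall>n. h n \<in> {i. (snd \<circ> f) i = (snd \<circ> f) i0}"
      using infinite_enumerate[OF inf] by (elim exE conjE)
    then show ?thesis by (intro that[of h]) (simp_all add: e_def)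
  qed
  obtain i j where ij: "i < j" "fst (f (h i)) \<le> fst (f (h j))"
    using dickson[of "\<lambda>k. fst (f (h k))"] by blast
  then obtain \<gamma> where \<gamma>: "fst (f (h j)) = fst (f (h i)) + \<gamma>" by (auto simp: expo_le_iff_add)
  have "e \<in> E" using \<open>\<And>i. snd (f i) \<in> E\<close>[of "h 0"] by (simp add: h(2))
  from module_ordering_add[OF mon least[OF this, of \<gamma>], of "fst (f (h i))"]
  have "((fst (f (h i)), e), (fst (f (h j)), e)) \<in> rE"
    using \<gamma> by (simp add: add.commute)
  then have "(f (h i), f (h j)) \<in> rE"
    using h(2)[of i] h(2)[of j] by (cases "f (h i)"; cases "f (h j)") simp
  moreover have "(f (h j), f (h i)) \<in> rE - Id" using desc h(1) ij(1) by (simp add: strict_mono_def)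
  ultimately show False using anti by (auto dest: antisymD)
qed

text \<open>A nonempty finite set of monomials has a largest element, which justifies the definite
description in \<^const>\<open>largest\<close>.\<close>

lemma largest_in_set:
  assumes module_ord_linear: "linear_order_on A r" and "X \<subseteq> A" "finite X" "X \<noteq> {}"
  shows "largest r X \<in> X" and "\<And>x. x \<in> X \<Longrightarrow> (x, largest r X) \<in> r"
proof -
  have props: "refl_on A r" "trans r" "antisym r" "total_on A r"
    using module_ord_linear by (auto simp: linear_order_on_def partial_order_on_def preorder_on_def)
  have "\<exists>m\<in>X. \<forall>x\<in>X. (x, m) \<in> r" using assms(3,4,2)
  proof (induction X rule: finite_ne_induct)
    case (singleton x)
    then show ?case using props(1) by (auto simp: refl_on_def)
  next
    case (insert y X)
    then obtain m where m: "m \<in> X" "\<forall>x\<in>X. (x, m) \<in> r" by auto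
    have "(y, m) \<in> r \<or> (m, y) \<in> r"
    proof -
      have "y \<in> A" "m \<in> A" using insert.prems m(1) by auto
      then show ?thesis using props(1,4) by (cases "y = m") (simp_all add: total_on_def refl_on_def)
    qed
    then show ?case
    proof
      assume "(m, y) \<in> r"
      then have "\<forall>x\<in>insert y X. (x, y) \<in> r"
        using m(2) props(2,1) insert.prems by (auto simp: refl_on_def dest: transD)
      then show ?thesis by blast
    qed (use m in blast)
  qed
  then have "\<exists>!m. m \<in> X \<and> (\<forall>x\<in>X. (x, m) \<in> r)" using props(3) by (auto dest: antisymD)
  from theI'[OF this]
  show "largest r X \<in> X" "\<And>x. x \<in> X \<Longrightarrow> (x, largest r X) \<in> r"
    by (auto simp: largest_def)
qed

text \<open>The exponent of the commutative image of a word.\<close>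

definition content :: "'n list \<Rightarrow> 'n expo" where
  "content w = (\<lambda>i. count_list w i)"

lemma content_append [simp]: "content (u @ v) = content u + content v"
  by (simp add: content_def fun_eq_iff)

lemma content_Nil [simp]: "content [] = 0"
  by (simp add: content_def fun_eq_iff)

lemma content_pair: "content [i, j] = var_expo i + var_expo j"
  by (auto simp: content_def var_expo_def fun_eq_iff)

lemma content_std_word [simp]: "content (std_word \<alpha>) = \<alpha>"
proof
  fix k
  have "count_list (concat (map (\<lambda>i. replicate (\<alpha> i) i) xs)) k = (if k \<in> set xs then \<alpha> k else 0)"
    if "distinct xs" for xs
    using that
  proof (induction xs)
    case (Cons x xs)
    have "count_list (replicate n x) k = (if k = x then n else 0)" for n by (induction n) auto
    then show ?case using Cons by auto
  qed simp
  from this[OF distinct_sorted_list_of_set]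
  show "content (std_word \<alpha>) k = \<alpha> k" by (simp add: content_def std_word_def)
qed

lemma std_word_eq_iff [simp]: "std_word \<alpha> = std_word \<beta> \<longleftrightarrow> \<alpha> = \<beta>"
  by (metis content_std_word)

lemma std_word_in_keys_iff [simp]: "std_word \<alpha> \<in> Poly_Mapping.keys f \<longleftrightarrow> \<alpha> \<in> expos f"
  by (simp add: expos_def in_keys_iff)

lemma finite_expos [simp]: "finite (expos f)"
proof -
  have "expos f \<subseteq> content ` Poly_Mapping.keys f"
    by (force simp flip: std_word_in_keys_iff)
  then show ?thesis by (rule finite_subset) simp
qed

lemma zero_list_eq_Nil [simp]: "(0 :: 'a list) = []"
  by (simp add: zero_list_def)

lemma mult_single_word [simp]:
  "Poly_Mapping.single u a * Poly_Mapping.single v b = Poly_Mapping.single (u @ v) (a * b)"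
  for a b :: "'k::semiring_0"
  by (simp add: mult_single plus_list_def)

lemma keys_mult_append:
  "w \<in> Poly_Mapping.keys (f * g) \<Longrightarrow> \<exists>u\<in>Poly_Mapping.keys f. \<exists>v\<in>Poly_Mapping.keys g. w = u @ v"
  using keys_mult[of f g] unfolding plus_list_def by blast

lemma lookup_scale [simp]:
  "Poly_Mapping.lookup (Poly_Mapping.single [] c * f) w = c * Poly_Mapping.lookup f w"
  for c :: "'k::field"
  by (simp flip: zero_list_eq_Nil mult_map_scale_conv_mult) (simp add: Poly_Mapping.map.rep_eq when_def)

lemma keys_scale: "Poly_Mapping.keys (Poly_Mapping.single [] c * f) \<subseteq> Poly_Mapping.keys f"
  for c :: "'k::field"
  by (auto simp: in_keys_iff)

lemma scale_1 [simp]: "Poly_Mapping.single [] 1 * f = f" for f :: "('n, 'k::field) fpoly"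
  by (rule poly_mapping_eqI) simp

lemma fpoly_eq_sum: "f = (\<Sum>w\<in>Poly_Mapping.keys f. Poly_Mapping.single w (Poly_Mapping.lookup f w))"
proof (rule poly_mapping_eqI)
  fix k
  show "Poly_Mapping.lookup f k = Poly_Mapping.lookup (\<Sum>w\<in>Poly_Mapping.keys f. Poly_Mapping.single w (Poly_Mapping.lookup f w)) k"
    by (simp add: lookup_sum lookup_single when_def in_keys_iff)
qed

lemma keys_minus_single:
  "Poly_Mapping.keys (f - Poly_Mapping.single w (Poly_Mapping.lookup f w)) = Poly_Mapping.keys f - {w}"
  for f :: "('n, 'k::field) fpoly"
proof (rule Set.set_eqI)
  fix v
  show "v \<in> Poly_Mapping.keys (f - Poly_Mapping.single w (Poly_Mapping.lookup f w)) \<longleftrightarrow> v \<in> Poly_Mapping.keys f - {w}"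
    by (cases "v = w") (simp_all add: in_keys_iff lookup_minus lookup_single)
qed

text \<open>Working with \<open>J\<close> directly in the type class ring of polynomials keeps the carrier sets of the
record-based algebra out of all computations; cosets only appear when the result is transferred
to the quotient.\<close>

locale two_sided_ideal =
  fixes J :: "('n, 'k::field) fpoly set"
  assumes zero_in: "0 \<in> J"
    and add_in: "\<lbrakk>f \<in> J; g \<in> J\<rbrakk> \<Longrightarrow> f + g \<in> J"
    and left_mult_in: "f \<in> J \<Longrightarrow> h * f \<in> J"
    and right_mult_in: "f \<in> J \<Longrightarrow> f * h \<in> J"
begin

definition congr :: "('n, 'k) fpoly \<Rightarrow> ('n, 'k) fpoly \<Rightarrow> bool" (infix "\<approx>" 50) where
  "f \<approx> g \<longleftrightarrow> f - g \<in> J"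

lemma uminus_in: "f \<in> J \<Longrightarrow> - f \<in> J"
  using left_mult_in[of f "-1"] by simp

lemma congr_refl [simp]: "f \<approx> f"
  by (simp add: congr_def zero_in)

lemma congr_sym: "f \<approx> g \<Longrightarrow> g \<approx> f"
  unfolding congr_def using uminus_in by fastforce

lemma congr_trans [trans]: "\<lbrakk>f \<approx> g; g \<approx> h\<rbrakk> \<Longrightarrow> f \<approx> h"
  unfolding congr_def using add_in[of "f - g" "g - h"] by simp

lemma congr_add: "\<lbrakk>f \<approx> g; f' \<approx> g'\<rbrakk> \<Longrightarrow> f + f' \<approx> g + g'"
  unfolding congr_def using add_in[of "f - g" "f' - g'"] by (simp add: algebra_simps)

lemma congr_uminus: "f \<approx> g \<Longrightarrow> - f \<approx> - g"
  unfolding congr_def using uminus_in[of "f - g"] by simp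

lemma congr_diff: "\<lbrakk>f \<approx> g; f' \<approx> g'\<rbrakk> \<Longrightarrow> f - f' \<approx> g - g'"
  using congr_add[OF _ congr_uminus] by simp

lemma congr_lmult: "f \<approx> g \<Longrightarrow> h * f \<approx> h * g"
  unfolding congr_def using left_mult_in[of "f - g" h] by (simp add: algebra_simps)

lemma congr_rmult: "f \<approx> g \<Longrightarrow> f * h \<approx> g * h"
  unfolding congr_def using right_mult_in[of "f - g" h] by (simp add: algebra_simps)

lemma congr_sum: "(\<And>x. x \<in> X \<Longrightarrow> f x \<approx> g x) \<Longrightarrow> sum f X \<approx> sum g X"
  by (induction X rule: infinite_finite_induct) (auto intro: congr_add)

lemma congr_0_iff: "f \<approx> 0 \<longleftrightarrow> f \<in> J"
  by (simp add: congr_def)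

end

lemma monomial_orderingD:
  assumes "monomial_ordering r"
  shows "trans r" "antisym r" "(\<alpha>, \<alpha>) \<in> r" "linear_order_on UNIV r"
    "(\<alpha>, \<beta>) \<in> r - Id \<Longrightarrow> (\<alpha> + \<gamma>, \<beta> + \<gamma>) \<in> r - Id"
  using assms by (auto simp: monomial_ordering_def linear_order_on_def partial_order_on_def preorder_on_def refl_on_def)

lemma monomial_ordering_strict_trans:
  assumes "monomial_ordering r" "(\<alpha>, \<beta>) \<in> r - Id" "(\<beta>, \<gamma>) \<in> r - Id"
  shows "(\<alpha>, \<gamma>) \<in> r - Id"
  using assms monomial_orderingD(1,2)[OF assms(1)] trans_diff_Id by (meson transD)

lemma monomial_ordering_le_strict_trans:
  assumes "monomial_ordering r" "(\<alpha>, \<beta>) \<in> r" "(\<beta>, \<gamma>) \<in> r - Id"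
  shows "(\<alpha>, \<gamma>) \<in> r - Id"
  using assms monomial_ordering_strict_trans by (cases "\<alpha> = \<beta>") blast+

text \<open>The ordering of exponents is extended to all words by comparing contents.  It is on this
scale that the tails \<open>d\<^sub>i\<^sub>j\<close> of the commutation relations are lower terms.\<close>

definition content_below :: "'n expo rel \<Rightarrow> 'n expo \<Rightarrow> ('n, 'k::field) fpoly \<Rightarrow> bool" where
  "content_below r \<alpha> f \<longleftrightarrow> (\<forall>v\<in>Poly_Mapping.keys f. (content v, \<alpha>) \<in> r - Id)"

lemma content_below_add: "\<lbrakk>content_below r \<alpha> f; content_below r \<alpha> g\<rbrakk> \<Longrightarrow> content_below r \<alpha> (f + g)"
  unfolding content_below_def using Poly_Mapping.keys_add[of f g] by blast

lemma content_below_diff: "\<lbrakk>content_below r \<alpha> f; content_below r \<alpha> g\<rbrakk> \<Longrightarrow> content_below r \<alpha> (f - g)"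
  unfolding content_below_def using Poly_Mapping.keys_diff[of f g] by blast

lemma content_below_scale: "content_below r \<alpha> f \<Longrightarrow> content_below r \<alpha> (Poly_Mapping.single [] c * f)"
  unfolding content_below_def using keys_scale[of c f] by blast

text \<open>A reduction step permutes two letters of one word, which keeps its content and multiplies the
coefficient by \<open>c\<^sub>i\<^sub>j \<noteq> 0\<close>, and adds terms of smaller content.  So along any chain of reductions
starting at \<open>w\<close> there is exactly one word of content \<open>content w\<close>.  At the end of the chain this
word is a standard word, that is, \<open>std_word (content w)\<close>.\<close>

lemma commutation_system_word:
  fixes J :: "('n::{finite,linorder}, 'k::field) fpoly set"
  assumes sys: "commutation_system S r" and "two_sided_ideal J" and "S \<subseteq> J"
  shows "\<exists>k f. k \<noteq> 0 \<and> Poly_Mapping.single w 1 - (Poly_Mapping.single (std_word (content w)) k + f) \<in> J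
    \<and> content_below r (content w) f"
proof -
  interpret two_sided_ideal J by fact
  from sys obtain c d where mon: "monomial_ordering r"
    and S: "S = {Poly_Mapping.single [j, i] 1 - Poly_Mapping.single [i, j] (c i j) - d i j | i j. i < j}"
    and cd: "\<And>i j. i < j \<Longrightarrow> c i j \<noteq> 0 \<and> d i j \<in> std_polys \<and>
           (d i j = 0 \<or> (le_poly r (d i j), var_expo i + var_expo j) \<in> r - Id)"
    and red: "\<And>f. \<exists>f'\<in>std_polys. (reduction_step c d)\<^sup>*\<^sup>* f f'"
    unfolding commutation_system_def by blast
  note r_order = monomial_orderingD[OF mon]
  define \<alpha> where "\<alpha> = content w"
  have dbelow: "content_below r (var_expo i + var_expo j) (d i j)" if "i < j" for i j
    unfolding content_below_def
  proof
    fix v assume v: "v \<in> Poly_Mapping.keys (d i j)"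
    then obtain \<xi> where \<xi>: "v = std_word \<xi>" using cd[of i j] \<open>i < j\<close> by (auto simp: std_polys_def)
    then have "\<xi> \<in> expos (d i j)" using v by simp
    then have "(\<xi>, le_poly r (d i j)) \<in> r"
      unfolding le_poly_def using largest_in_set(2)[OF r_order(4), of "expos (d i j)" \<xi>] by fastforce
    moreover have "d i j \<noteq> 0" using v by auto
    ultimately show "(content v, var_expo i + var_expo j) \<in> r - Id"
      using monomial_ordering_le_strict_trans[OF mon] cd[of i j] \<open>i < j\<close> \<xi> by simp
  qed
  \<comment> \<open>exactly one word of content \<alpha>, and everything else below\<close>
  define Inv where "Inv = (\<lambda>g. \<exists>v k f. k \<noteq> 0 \<and> content v = \<alpha> \<and> g = Poly_Mapping.single v k + f
      \<and> content_below r \<alpha> f \<and> Poly_Mapping.single w 1 \<approx> g)"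
  have step: "Inv g'" if "Inv g" and st: "reduction_step c d g g'" for g g'
  proof -
    from \<open>Inv g\<close> obtain v k f where k: "k \<noteq> 0" and v: "content v = \<alpha>"
      and g: "g = Poly_Mapping.single v k + f" and f: "content_below r \<alpha> f"
      and wg: "Poly_Mapping.single w 1 \<approx> g"
      unfolding Inv_def by blast
    from st obtain i j m m' a where "i < j" and a: "a = Poly_Mapping.lookup g (m @ [j, i] @ m')"
      and g': "g' = g - Poly_Mapping.single (m @ [j, i] @ m') a
               + Poly_Mapping.single m a * (Poly_Mapping.single [i, j] (c i j) + d i j)
                   * Poly_Mapping.single m' 1"
      unfolding reduction_step_def by blast
    define u where "u = m @ [j, i] @ m'"
    define t where "t = Poly_Mapping.single m a * d i j * Poly_Mapping.single m' 1"
    have g'2: "g' = g - Poly_Mapping.single u a + Poly_Mapping.single (m @ [i, j] @ m') (a * c i j) + t"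
      unfolding g' u_def t_def by (simp add: distrib_left distrib_right)
    have "g - g' = Poly_Mapping.single m a * (Poly_Mapping.single [j, i] 1 - Poly_Mapping.single [i, j] (c i j) - d i j) * Poly_Mapping.single m' 1"
      unfolding g' by (simp add: distrib_left distrib_right left_diff_distrib right_diff_distrib)
    moreover have "Poly_Mapping.single [j, i] 1 - Poly_Mapping.single [i, j] (c i j) - d i j \<in> J"
      using \<open>i < j\<close> S \<open>S \<subseteq> J\<close> by blast
    ultimately have "g \<approx> g'" unfolding congr_def by (simp add: left_mult_in right_mult_in)
    then have wg': "Poly_Mapping.single w 1 \<approx> g'" using wg congr_trans by blast
    have contu: "content u = content m + (var_expo i + var_expo j) + content m'"
      by (simp only: u_def content_append content_pair ac_simps)
    have contu': "content (m @ [i, j] @ m') = content u"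
      by (simp only: contu content_append content_pair ac_simps)
    have tbelow: "content_below r (content u) t"
      unfolding content_below_def
    proof
      fix x assume "x \<in> Poly_Mapping.keys t"
      then obtain y where y: "y \<in> Poly_Mapping.keys (d i j)" and x: "x = m @ y @ m'"
        unfolding t_def by (fastforce dest!: keys_mult_append split: if_splits)
      have "(content y, var_expo i + var_expo j) \<in> r - Id"
        using dbelow[OF \<open>i < j\<close>] y by (simp add: content_below_def)
      from r_order(5)[OF this, of "content m + content m'"]
      show "(content x, content u) \<in> r - Id" by (simp add: x contu ac_simps)
    qed
    show ?thesis
    proof (cases "u = v")
      case True
      have "Poly_Mapping.lookup f u = 0"
        using f True v by (auto simp: content_below_def in_keys_iff)
      then have "a = k" using a g True unfolding u_def[symmetric] by (simp add: lookup_add)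
      then have "g' = Poly_Mapping.single (m @ [i, j] @ m') (k * c i j) + (f + t)"
        unfolding g'2 g True by simp
      moreover have "content_below r \<alpha> (f + t)" using f tbelow True v by (auto intro: content_below_add)
      moreover have "k * c i j \<noteq> 0" using k cd[OF \<open>i < j\<close>] by simp
      ultimately show ?thesis unfolding Inv_def using wg' contu' True v by blast
    next
      case False
      then have a': "a = Poly_Mapping.lookup f u" using a g unfolding u_def[symmetric] by (simp add: lookup_add lookup_single)
      show ?thesis
      proof (cases "a = 0")
        case True
        then have "g' = g" unfolding g' by simp
        then show ?thesis using \<open>Inv g\<close> by simp
      next
        case False
        then have "u \<in> Poly_Mapping.keys f" using a' by (simp add: in_keys_iff)
        then have u: "(content u, \<alpha>) \<in> r - Id" using f by (simp add: content_below_def)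
        then have 1: "content_below r \<alpha> t"
          using tbelow monomial_ordering_strict_trans[OF mon] unfolding content_below_def by blast
        have 2: "content_below r \<alpha> (Poly_Mapping.single (m @ [i, j] @ m') (a * c i j))"
          "content_below r \<alpha> (Poly_Mapping.single u a)"
          using u contu' by (auto simp: content_below_def split: if_splits)
        have "content_below r \<alpha>
            (f - Poly_Mapping.single u a + Poly_Mapping.single (m @ [i, j] @ m') (a * c i j) + t)"
          by (intro content_below_add content_below_diff f 1 2)
        moreover have "g' = Poly_Mapping.single v k +
            (f - Poly_Mapping.single u a + Poly_Mapping.single (m @ [i, j] @ m') (a * c i j) + t)"
          unfolding g'2 g by (simp only: add_diff_eq add.assoc[symmetric])
        ultimately show ?thesis unfolding Inv_def using wg' k v by blast
      qed
    qed
  qed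
  have "Poly_Mapping.single w 1 = Poly_Mapping.single w 1 + (0 :: ('n, 'k) fpoly)"
    "content_below r \<alpha> (0 :: ('n, 'k) fpoly)"
    by (auto simp: content_below_def)
  then have init: "Inv (Poly_Mapping.single w 1)"
    unfolding Inv_def using \<alpha>_def congr_refl one_neq_zero by blast
  obtain g where g: "g \<in> std_polys" "(reduction_step c d)\<^sup>*\<^sup>* (Poly_Mapping.single w 1) g"
    using red by blast
  from g(2) have "Inv g" by (induction rule: rtranclp_induct) (use init step in auto)
  then obtain v k f where k: "k \<noteq> 0" and v: "content v = \<alpha>"
      and g2: "g = Poly_Mapping.single v k + f" and f: "content_below r \<alpha> f"
      and wg: "Poly_Mapping.single w 1 \<approx> g"
    unfolding Inv_def by blast
  have "Poly_Mapping.lookup f v = 0"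
    using f v by (auto simp: content_below_def in_keys_iff)
  then have "v \<in> Poly_Mapping.keys g" using k by (simp add: g2 in_keys_iff lookup_add)
  then obtain \<beta> where "v = std_word \<beta>" using g(1) by (auto simp: std_polys_def)
  then have "v = std_word \<alpha>" using v by simp
  then show ?thesis using k f wg g2 unfolding \<alpha>_def congr_def by blast
qed

section \<open>Normal forms in a PBW-reduction-algebra\<close>

text \<open>What the theory of normal forms needs to know about one PBW-reduction datum.  The set \<open>L\<close> is
that of the reducible exponents.\<close>

locale pbw_normal_form = two_sided_ideal J
  for J :: "('n::{finite,linorder}, 'k::field) fpoly set" +
  fixes r :: "'n expo rel" and L :: "'n expo set"
  assumes mon: "monomial_ordering r"
    and wf_r: "wf (r - Id)"
    and word_congr: "\<exists>k f. k \<noteq> 0 \<and>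
      Poly_Mapping.single w 1 - (Poly_Mapping.single (std_word (content w)) k + f) \<in> J \<and>
      content_below r (content w) f"
    and L_eq: "L = l_set r (J \<inter> std_polys)"
begin

lemmas r_order = monomial_orderingD[OF mon]

text \<open>Combinations of irreducible standard monomials with exponents in \<open>X\<close>.  The parameter \<open>X\<close>
carries the bounds on leading exponents through the construction of normal forms.\<close>

definition irreducibles :: "'n expo set \<Rightarrow> ('n, 'k) fpoly set" where
  "irreducibles X = {q. \<forall>v\<in>Poly_Mapping.keys q. \<exists>\<alpha>\<in>X - L. v = std_word \<alpha>}"

lemma irreducibles_mono: "\<lbrakk>q \<in> irreducibles X; X \<subseteq> Y\<rbrakk> \<Longrightarrow> q \<in> irreducibles Y"
  by (fastforce simp: irreducibles_def)

lemma irreducibles_0: "0 \<in> irreducibles X"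
  by (simp add: irreducibles_def)

lemma irreducibles_add: "\<lbrakk>p \<in> irreducibles X; q \<in> irreducibles X\<rbrakk> \<Longrightarrow> p + q \<in> irreducibles X"
  unfolding irreducibles_def using Poly_Mapping.keys_add[of p q] by blast

lemma irreducibles_diff: "\<lbrakk>p \<in> irreducibles X; q \<in> irreducibles X\<rbrakk> \<Longrightarrow> p - q \<in> irreducibles X"
  unfolding irreducibles_def using Poly_Mapping.keys_diff[of p q] by blast

lemma irreducibles_scale: "p \<in> irreducibles X \<Longrightarrow> Poly_Mapping.single [] c * p \<in> irreducibles X"
  unfolding irreducibles_def using keys_scale[of c p] by blast

lemma irreducibles_sum: "(\<And>i. i \<in> B \<Longrightarrow> f i \<in> irreducibles X) \<Longrightarrow> sum f B \<in> irreducibles X"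
  by (induction B rule: infinite_finite_induct) (auto intro: irreducibles_0 irreducibles_add)

lemma irreducibles_iff: "q \<in> irreducibles UNIV \<longleftrightarrow> q \<in> std_polys \<and> expos q \<inter> L = {}"
proof
  assume q: "q \<in> irreducibles UNIV"
  have "\<alpha> \<notin> L" if "\<alpha> \<in> expos q" for \<alpha>
  proof -
    have "std_word \<alpha> \<in> Poly_Mapping.keys q" using that by simp
    then obtain \<beta> where "\<beta> \<notin> L" "std_word \<alpha> = std_word \<beta>" using q unfolding irreducibles_def by blast
    then show ?thesis by simp
  qed
  then show "q \<in> std_polys \<and> expos q \<inter> L = {}"
    using q unfolding irreducibles_def std_polys_def by blast
next
  assume "q \<in> std_polys \<and> expos q \<inter> L = {}"
  then show "q \<in> irreducibles UNIV"
    unfolding irreducibles_def std_polys_def using std_word_in_keys_iff by blast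
qed

lemma expos_irreducible:
  assumes "q \<in> irreducibles X" "\<alpha> \<in> expos q" shows "\<alpha> \<in> X" "\<alpha> \<notin> L"
proof -
  have "std_word \<alpha> \<in> Poly_Mapping.keys q" using assms(2) by simp
  then obtain \<beta> where "\<beta> \<in> X - L" "std_word \<alpha> = std_word \<beta>" using assms(1) unfolding irreducibles_def by blast
  then show "\<alpha> \<in> X" "\<alpha> \<notin> L" by simp_all
qed

lemma le_poly_in_expos:
  assumes "f \<in> std_polys" "f \<noteq> 0"
  shows "le_poly r f \<in> expos f" and "\<And>\<alpha>. \<alpha> \<in> expos f \<Longrightarrow> (\<alpha>, le_poly r f) \<in> r"
proof -
  have ne: "expos f \<noteq> {}"
  proof
    assume "expos f = {}"
    then have "Poly_Mapping.keys f = {}" using assms(1) std_word_in_keys_iff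
      unfolding std_polys_def by blast
    then show False using assms(2) by simp
  qed
  show "le_poly r f \<in> expos f" "\<And>\<alpha>. \<alpha> \<in> expos f \<Longrightarrow> (\<alpha>, le_poly r f) \<in> r"
    unfolding le_poly_def using largest_in_set[OF r_order(4) subset_UNIV finite_expos ne] by auto
qed

text \<open>The leading exponent of a nonzero standard polynomial in \<open>J\<close> is reducible by the choice of
\<open>L\<close>.  This gives the uniqueness of normal forms.\<close>

lemma irreducible_in_J_eq_0:
  assumes "q \<in> irreducibles UNIV" "q \<in> J"
  shows "q = 0"
proof (rule ccontr)
  assume "q \<noteq> 0"
  moreover have "q \<in> std_polys" using assms(1) irreducibles_iff by blast
  ultimately have "le_poly r q \<in> expos q" "le_poly r q \<in> L"
    using le_poly_in_expos(1) assms(2) unfolding L_eq l_set_def by blast+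
  then show False using assms(1) irreducibles_iff by blast
qed

lemma irreducible_congr_of_words:
  assumes "\<And>v. v \<in> Poly_Mapping.keys f \<Longrightarrow> \<exists>q\<in>irreducibles X. Poly_Mapping.single v 1 \<approx> q"
  shows "\<exists>q\<in>irreducibles X. f \<approx> q"
proof -
  obtain q where q: "\<And>v. v \<in> Poly_Mapping.keys f \<Longrightarrow> q v \<in> irreducibles X \<and> Poly_Mapping.single v 1 \<approx> q v"
    using assms by metis
  define p where "p = (\<Sum>v\<in>Poly_Mapping.keys f. Poly_Mapping.single [] (Poly_Mapping.lookup f v) * q v)"
  have "(\<Sum>v\<in>Poly_Mapping.keys f. Poly_Mapping.single [] (Poly_Mapping.lookup f v) * Poly_Mapping.single v 1) \<approx> p"
    unfolding p_def using q by (intro congr_sum congr_lmult) blast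
  then have "f \<approx> p" by (simp flip: fpoly_eq_sum)
  moreover have "p \<in> irreducibles X" unfolding p_def using q by (intro irreducibles_sum irreducibles_scale) blast
  ultimately show ?thesis by blast
qed

text \<open>Induction on the content \<open>\<alpha>\<close> of \<open>w\<close>.  Up to lower words, \<open>w\<close> is a nonzero multiple of \<open>x\<^sup>\<alpha>\<close>,
which is either irreducible itself or the leading monomial of an element of \<open>J\<close>, and then it can
be replaced by lower terms.\<close>

lemma word_normal_form:
  "\<exists>q\<in>irreducibles {\<beta>. (\<beta>, content w) \<in> r}. Poly_Mapping.single w 1 \<approx> q \<and>
     (content w \<notin> L \<longrightarrow> content w \<in> expos q)"
proof (induction "content w" arbitrary: w rule: wf_induct_rule[OF wf_r])
  case (1 w)
  define \<alpha> where "\<alpha> = content w"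
  have below: "\<exists>q\<in>irreducibles {\<beta>. (\<beta>, \<alpha>) \<in> r - Id}. f \<approx> q" if f: "content_below r \<alpha> f" for f
  proof (rule irreducible_congr_of_words)
    fix v assume "v \<in> Poly_Mapping.keys f"
    then have v: "(content v, \<alpha>) \<in> r - Id" using f by (simp add: content_below_def)
    then obtain q where "q \<in> irreducibles {\<beta>. (\<beta>, content v) \<in> r}" "Poly_Mapping.single v 1 \<approx> q"
      using 1 unfolding \<alpha>_def by blast
    moreover have "{\<beta>. (\<beta>, content v) \<in> r} \<subseteq> {\<beta>. (\<beta>, \<alpha>) \<in> r - Id}"
      using monomial_ordering_le_strict_trans[OF mon _ v] by blast
    ultimately show "\<exists>q\<in>irreducibles {\<beta>. (\<beta>, \<alpha>) \<in> r - Id}. Poly_Mapping.single v 1 \<approx> q"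
      using irreducibles_mono by blast
  qed
  obtain k f where k: "k \<noteq> 0" and w: "Poly_Mapping.single w 1 \<approx> Poly_Mapping.single (std_word \<alpha>) k + f"
    and f: "content_below r \<alpha> f"
    using word_congr[of w] unfolding \<alpha>_def congr_def by blast
  show ?case
  proof (cases "\<alpha> \<in> L")
    case False
    obtain q where q: "q \<in> irreducibles {\<beta>. (\<beta>, \<alpha>) \<in> r - Id}" "f \<approx> q" using below[OF f] by blast
    have "Poly_Mapping.single (std_word \<alpha>) k \<in> irreducibles {\<beta>. (\<beta>, \<alpha>) \<in> r}"
      using False r_order(3) by (simp add: irreducibles_def)
    moreover have "q \<in> irreducibles {\<beta>. (\<beta>, \<alpha>) \<in> r}" using q(1) by (rule irreducibles_mono) blast
    ultimately have "Poly_Mapping.single (std_word \<alpha>) k + q \<in> irreducibles {\<beta>. (\<beta>, \<alpha>) \<in> r}"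
      by (rule irreducibles_add)
    moreover have "Poly_Mapping.single w 1 \<approx> Poly_Mapping.single (std_word \<alpha>) k + q"
      using w congr_add[OF congr_refl q(2)] by (rule congr_trans)
    moreover have "std_word \<alpha> \<notin> Poly_Mapping.keys q"
      using expos_irreducible(1)[OF q(1), of \<alpha>] by auto
    then have "\<alpha> \<in> expos (Poly_Mapping.single (std_word \<alpha>) k + q)"
      using k by (simp add: expos_def lookup_add)
    ultimately show ?thesis unfolding \<alpha>_def by blast
  next
    case True
    \<comment> \<open>The polynomial \<open>p\<close> rewrites the leading monomial by its lower terms \<open>p'\<close>.\<close>
    then obtain p where p: "p \<in> J" "p \<in> std_polys" "p \<noteq> 0" "\<alpha> = le_poly r p"
      unfolding L_eq l_set_def by blast
    define c where "c = Poly_Mapping.lookup p (std_word \<alpha>)"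
    have "c \<noteq> 0" using le_poly_in_expos(1)[OF p(2,3)] p(4) by (simp add: c_def expos_def)
    define p' where "p' = p - Poly_Mapping.single (std_word \<alpha>) c"
    have "content_below r \<alpha> p'"
      unfolding content_below_def
    proof
      fix v assume "v \<in> Poly_Mapping.keys p'"
      then have v: "v \<in> Poly_Mapping.keys p" "v \<noteq> std_word \<alpha>"
        unfolding p'_def c_def keys_minus_single by auto
      then obtain \<beta> where \<beta>: "v = std_word \<beta>" using p(2) by (auto simp: std_polys_def)
      then show "(content v, \<alpha>) \<in> r - Id" using le_poly_in_expos(2)[OF p(2,3), of \<beta>] v p(4) by auto
    qed
    then have b: "content_below r \<alpha> (f - Poly_Mapping.single [] (k / c) * p')"
      by (intro content_below_diff content_below_scale f)
    have "Poly_Mapping.single (std_word \<alpha>) k - Poly_Mapping.single [] (k / c) * p = - (Poly_Mapping.single [] (k / c) * p')"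
      using \<open>c \<noteq> 0\<close> by (simp add: p'_def right_diff_distrib)
    moreover have "Poly_Mapping.single (std_word \<alpha>) k \<approx> Poly_Mapping.single (std_word \<alpha>) k - Poly_Mapping.single [] (k / c) * p"
      unfolding congr_def using left_mult_in[OF p(1)] by simp
    ultimately have "Poly_Mapping.single (std_word \<alpha>) k \<approx> - (Poly_Mapping.single [] (k / c) * p')" by simp
    from congr_trans[OF w congr_add[OF this congr_refl]]
    have w': "Poly_Mapping.single w 1 \<approx> f - Poly_Mapping.single [] (k / c) * p'" by simp
    obtain q where q: "q \<in> irreducibles {\<beta>. (\<beta>, \<alpha>) \<in> r - Id}" "f - Poly_Mapping.single [] (k / c) * p' \<approx> q"
      using below[OF b] by blast
    have "q \<in> irreducibles {\<beta>. (\<beta>, \<alpha>) \<in> r}" using q(1) by (rule irreducibles_mono) blast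
    moreover have "Poly_Mapping.single w 1 \<approx> q" using w' q(2) by (rule congr_trans)
    ultimately show ?thesis using True unfolding \<alpha>_def by blast
  qed
qed

lemma normal_form_exists:
  "\<exists>q\<in>irreducibles {\<beta>. \<exists>v\<in>Poly_Mapping.keys f. (\<beta>, content v) \<in> r}. f \<approx> q"
proof (rule irreducible_congr_of_words)
  fix v assume v: "v \<in> Poly_Mapping.keys f"
  obtain q where q: "q \<in> irreducibles {\<beta>. (\<beta>, content v) \<in> r}" "Poly_Mapping.single v 1 \<approx> q"
    using word_normal_form[of v] by blast
  have "{\<beta>. (\<beta>, content v) \<in> r} \<subseteq> {\<beta>. \<exists>v\<in>Poly_Mapping.keys f. (\<beta>, content v) \<in> r}"
    using v by blast
  then show "\<exists>q\<in>irreducibles {\<beta>. \<exists>v\<in>Poly_Mapping.keys f. (\<beta>, content v) \<in> r}. Poly_Mapping.single v 1 \<approx> q"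
    using q irreducibles_mono by blast
qed

definition nf :: "('n, 'k) fpoly \<Rightarrow> ('n, 'k) fpoly" where
  "nf f = (THE q. q \<in> irreducibles UNIV \<and> f \<approx> q)"

lemma nf_eqI:
  assumes "q \<in> irreducibles UNIV" "f \<approx> q"
  shows "nf f = q"
  unfolding nf_def
proof (rule the_equality)
  fix p assume p: "p \<in> irreducibles UNIV \<and> f \<approx> p"
  then have "p \<approx> q" using assms(2) congr_sym congr_trans by blast
  then have "p - q = 0"
    using p assms(1) irreducible_in_J_eq_0 irreducibles_diff unfolding congr_def by blast
  then show "p = q" by simp
qed (use assms in blast)

lemma nf_props: "nf f \<in> irreducibles UNIV" "f \<approx> nf f"
  and nf_bound: "nf f \<in> irreducibles {\<beta>. \<exists>v\<in>Poly_Mapping.keys f. (\<beta>, content v) \<in> r}"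
proof -
  obtain q where q: "q \<in> irreducibles {\<beta>. \<exists>v\<in>Poly_Mapping.keys f. (\<beta>, content v) \<in> r}" "f \<approx> q"
    using normal_form_exists by blast
  then have "nf f = q" using nf_eqI irreducibles_mono by blast
  then show "nf f \<in> irreducibles UNIV" "f \<approx> nf f"
    "nf f \<in> irreducibles {\<beta>. \<exists>v\<in>Poly_Mapping.keys f. (\<beta>, content v) \<in> r}"
    using q irreducibles_mono by blast+
qed

lemma nf_cong: "f \<approx> g \<Longrightarrow> nf f = nf g"
  using nf_eqI nf_props congr_trans by blast

lemma nf_eq_0_iff: "nf f = 0 \<longleftrightarrow> f \<in> J"
  using nf_eqI[OF irreducibles_0, of f] nf_props(2)[of f] congr_0_iff[of f] by auto

lemma nf_add: "nf (f + g) = nf f + nf g"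
  by (intro nf_eqI irreducibles_add congr_add nf_props)

lemma nf_diff: "nf (f - g) = nf f - nf g"
  by (intro nf_eqI irreducibles_diff congr_diff nf_props)

lemma nf_scale: "nf (Poly_Mapping.single [] c * f) = Poly_Mapping.single [] c * nf f"
  by (intro nf_eqI irreducibles_scale congr_lmult nf_props)

lemma expos_nf_bound:
  "\<alpha> \<in> expos (nf f) \<Longrightarrow> \<exists>v\<in>Poly_Mapping.keys f. (\<alpha>, content v) \<in> r"
  using expos_irreducible(1)[OF nf_bound] by blast

lemma expos_nf_irreducible: "\<alpha> \<in> expos (nf f) \<Longrightarrow> \<alpha> \<notin> L"
  using expos_irreducible(2)[OF nf_bound] by blast

lemma keys_nf: "v \<in> Poly_Mapping.keys (nf f) \<Longrightarrow> v = std_word (content v) \<and> content v \<in> expos (nf f)"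
  using nf_props(1)[of f] unfolding irreducibles_def by (auto simp flip: std_word_in_keys_iff)

text \<open>The irreducible leading term of \<open>f\<close> survives in its normal form: no lower word contributes to
its coefficient.\<close>

lemma nf_top:
  assumes w: "w \<in> Poly_Mapping.keys f" and irr: "content w \<notin> L"
    and lower: "\<And>v. v \<in> Poly_Mapping.keys f - {w} \<Longrightarrow> (content v, content w) \<in> r - Id"
  shows "content w \<in> expos (nf f)"
proof -
  define c where "c = Poly_Mapping.lookup f w"
  define f' where "f' = f - Poly_Mapping.single w c"
  have c: "c \<noteq> 0" using w by (simp add: c_def in_keys_iff)
  have keys': "Poly_Mapping.keys f' = Poly_Mapping.keys f - {w}"
    unfolding f'_def c_def by (rule keys_minus_single)
  have "f = Poly_Mapping.single [] c * Poly_Mapping.single w 1 + f'" by (simp add: f'_def)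
  then have nf: "nf f = Poly_Mapping.single [] c * nf (Poly_Mapping.single w 1) + nf f'"
    using nf_add nf_scale by metis
  obtain q where q: "q \<in> irreducibles {\<beta>. (\<beta>, content w) \<in> r}" "Poly_Mapping.single w 1 \<approx> q" "content w \<in> expos q"
    using word_normal_form[of w] irr by blast
  have "nf (Poly_Mapping.single w 1) = q" using q irreducibles_mono nf_eqI by blast
  then have "Poly_Mapping.lookup (nf (Poly_Mapping.single w 1)) (std_word (content w)) \<noteq> 0"
    using q(3) by (simp add: expos_def)
  moreover have "content w \<notin> expos (nf f')"
  proof
    assume "content w \<in> expos (nf f')"
    then obtain v where v: "v \<in> Poly_Mapping.keys f'" "(content w, content v) \<in> r"
      using expos_nf_bound by blast
    then have "(content v, content w) \<in> r - Id" using lower keys' by blast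
    then show False using monomial_ordering_le_strict_trans[OF mon v(2)] by blast
  qed
  ultimately show ?thesis using c by (simp add: nf expos_def lookup_add)
qed

text \<open>Both words are congruent to nonzero multiples of the same standard monomial up to lower
terms.\<close>

lemma same_content_congr:
  assumes "content v = content w"
  shows "\<exists>k f. k \<noteq> 0 \<and> content_below r (content w) f \<and>
    Poly_Mapping.single v 1 \<approx> Poly_Mapping.single w k + f"
proof -
  obtain a f where a: "a \<noteq> 0" "content_below r (content w) f"
    "Poly_Mapping.single v 1 \<approx> Poly_Mapping.single (std_word (content w)) a + f"
    using word_congr[of v] assms unfolding congr_def by auto
  obtain b g where b: "b \<noteq> 0" "content_below r (content w) g"
    "Poly_Mapping.single w 1 \<approx> Poly_Mapping.single (std_word (content w)) b + g"
    using word_congr[of w] unfolding congr_def by auto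
  define c where "c = Poly_Mapping.single ([] :: 'n list) (a / b)"
  have "c * Poly_Mapping.single w 1 \<approx> c * (Poly_Mapping.single (std_word (content w)) b + g)"
    using b(3) by (rule congr_lmult)
  then have "Poly_Mapping.single (std_word (content w)) a \<approx> Poly_Mapping.single w (a / b) - c * g"
    unfolding congr_def using b(1) congr_sym[unfolded congr_def]
    by (simp add: c_def distrib_left diff_diff_eq2 add_diff_eq flip: diff_diff_eq)
  from congr_trans[OF a(3) congr_add[OF this congr_refl]]
  have "Poly_Mapping.single v 1 \<approx> Poly_Mapping.single w (a / b) + (f - c * g)" by (simp add: algebra_simps)
  moreover have "content_below r (content w) (f - c * g)"
    unfolding c_def by (intro content_below_diff content_below_scale a b)
  ultimately show ?thesis using a(1) b(1) by (intro exI[of _ "a / b"] exI[of _ "f - c * g"]) simp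
qed

end

section \<open>Leading monomials of vectors\<close>

lemma lookup_single_mult: "Poly_Mapping.lookup (Poly_Mapping.single w c * q) (w @ v) = c * Poly_Mapping.lookup q v"
  for q :: "('n, 'k::field) fpoly"
proof -
  have "Poly_Mapping.single w c * q =
      (\<Sum>u\<in>Poly_Mapping.keys q. Poly_Mapping.single (w @ u) (c * Poly_Mapping.lookup q u))"
    by (subst fpoly_eq_sum[of q]) (simp add: sum_distrib_left)
  then show ?thesis by (simp add: lookup_sum lookup_single when_def in_keys_iff)
qed

lemma keys_single_mult: "u \<in> Poly_Mapping.keys (Poly_Mapping.single w c * q) \<Longrightarrow> \<exists>v\<in>Poly_Mapping.keys q. u = w @ v"
  for q :: "('n, 'k::field) fpoly"
  by (fastforce dest!: keys_mult_append split: if_splits)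

definition left_mult :: "('n, 'k::field) fpoly \<Rightarrow> ('e \<Rightarrow> ('n, 'k) fpoly) \<Rightarrow> 'e \<Rightarrow> ('n, 'k) fpoly" (infixr "\<cdot>" 75) where
  "h \<cdot> U = (\<lambda>e. h * U e)"

lemma left_mult_left_mult [simp]: "h \<cdot> h' \<cdot> U = (h * h') \<cdot> U"
  by (simp add: left_mult_def mult.assoc)

lemma left_mult_add: "h \<cdot> (U + W) = h \<cdot> U + h \<cdot> W"
  by (simp add: left_mult_def distrib_left fun_eq_iff)

lemma left_mult_diff: "h \<cdot> (U - W) = h \<cdot> U - h \<cdot> W"
  by (simp add: left_mult_def right_diff_distrib fun_eq_iff)

lemma left_mult_1 [simp]: "Poly_Mapping.single [] 1 \<cdot> U = U"
  by (simp add: left_mult_def)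

lemma shift_shift [simp]: "shift \<gamma> (shift \<delta> s) = shift (\<gamma> + \<delta>) s"
  by (simp add: shift_def add_ac)

lemma snd_shift [simp]: "snd (shift \<gamma> s) = snd s"
  by (simp add: shift_def)

lemma shift_pair [simp]: "shift \<gamma> (\<alpha>, e) = (\<alpha> + \<gamma>, e)"
  by (simp add: shift_def)

text \<open>The algebra is given by \<open>J\<close>; the components only differ in their orderings and in the
reducible exponents \<open>L e\<close>.\<close>

locale pbw_free_module = two_sided_ideal J
  for J :: "('n::{finite,linorder}, 'k::field) fpoly set" +
  fixes E :: "'e set" and rE :: "('n expo \<times> 'e) rel" and L :: "'e \<Rightarrow> 'n expo set"
  assumes finite_E: "finite E"
    and module_ord: "module_monomial_ordering E rE"
    and wf_rE: "wf (rE - Id)"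
    and component: "e \<in> E \<Longrightarrow> pbw_normal_form J (induced_ordering rE e) (L e)"
    and L_add: "\<lbrakk>e \<in> E; \<alpha> \<in> L e\<rbrakk> \<Longrightarrow> \<alpha> + \<gamma> \<in> L e"
begin

abbreviation le_mon (infix "\<preceq>" 50) where "s \<preceq> t \<equiv> (s, t) \<in> rE"
abbreviation less_mon (infix "\<prec>" 50) where "s \<prec> t \<equiv> (s, t) \<in> rE - Id"

abbreviation upto_mon :: "'n expo \<times> 'e \<Rightarrow> ('n expo \<times> 'e) set" where
  "upto_mon t \<equiv> {s. s \<preceq> t}"
abbreviation below_mon :: "'n expo \<times> 'e \<Rightarrow> ('n expo \<times> 'e) set" where
  "below_mon t \<equiv> {s. s \<prec> t}"

lemma module_ord_linear: "linear_order_on (UNIV \<times> E) rE"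
  using module_ord by (simp add: module_monomial_ordering_def)

lemma rE_order: "trans rE" "antisym rE" "rE \<subseteq> (UNIV \<times> E) \<times> (UNIV \<times> E)" "e \<in> E \<Longrightarrow> (\<alpha>, e) \<preceq> (\<alpha>, e)"
  using module_ord_linear by (auto simp: linear_order_on_def partial_order_on_def preorder_on_def refl_on_def)

lemma mon_le_trans [trans]: "\<lbrakk>s \<preceq> t; t \<preceq> u\<rbrakk> \<Longrightarrow> s \<preceq> u"
  using rE_order(1) by (rule transD)

lemma mon_le_less_trans: "\<lbrakk>s \<preceq> t; t \<prec> u\<rbrakk> \<Longrightarrow> s \<prec> u"
  using rE_order(1,2) by (auto dest: transD antisymD)

lemma mon_less_irrefl: "\<not> s \<prec> s"
  by simp

lemma snd_in_E: "s \<preceq> t \<Longrightarrow> snd s \<in> E \<and> snd t \<in> E"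
  using rE_order(3) by auto

lemma mon_le_refl: "snd s \<in> E \<Longrightarrow> s \<preceq> s"
  using rE_order(4) by (cases s) auto

lemma shift_le: "s \<preceq> t \<Longrightarrow> shift \<gamma> s \<preceq> shift \<gamma> t"
  using module_ordering_add[OF module_ord] by (cases s; cases t) simp

lemma shift_less: "s \<prec> t \<Longrightarrow> shift \<gamma> s \<prec> shift \<gamma> t"
  using module_ord unfolding module_monomial_ordering_def by (cases s; cases t) auto

lemma shift_less_left:
  assumes "(\<gamma>, \<delta>) \<in> induced_ordering rE (snd s) - Id"
  shows "shift \<gamma> s \<prec> shift \<delta> s"
proof -
  have "(\<gamma>, snd s) \<prec> (\<delta>, snd s)" using assms by (auto simp: induced_ordering_def)
  from shift_less[OF this, of "fst s"] show ?thesis by (simp add: shift_def add.commute)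
qed

text \<open>Vectors are compared on \<open>E\<close> only; their values outside of \<open>E\<close> carry no meaning.\<close>

definition vcongr :: "('e \<Rightarrow> ('n, 'k) fpoly) \<Rightarrow> ('e \<Rightarrow> ('n, 'k) fpoly) \<Rightarrow> bool" (infix "\<doteq>" 50) where
  "U \<doteq> W \<longleftrightarrow> (\<forall>e\<in>E. U e \<approx> W e)"

lemma vcongr_refl [simp]: "U \<doteq> U"
  by (simp add: vcongr_def)

lemma vcongr_trans [trans]: "\<lbrakk>U \<doteq> W; W \<doteq> X\<rbrakk> \<Longrightarrow> U \<doteq> X"
  unfolding vcongr_def using congr_trans by blast

lemma vcongr_add: "\<lbrakk>U \<doteq> U'; W \<doteq> W'\<rbrakk> \<Longrightarrow> U + W \<doteq> U' + W'"
  by (simp add: vcongr_def congr_add)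

lemma vcongr_diff: "\<lbrakk>U \<doteq> U'; W \<doteq> W'\<rbrakk> \<Longrightarrow> U - W \<doteq> U' - W'"
  by (simp add: vcongr_def congr_diff)

lemma vcongr_left_mult: "U \<doteq> W \<Longrightarrow> h \<cdot> U \<doteq> h \<cdot> W"
  by (simp add: vcongr_def left_mult_def congr_lmult)

lemma vcongr_left_mult_left: "h \<approx> h' \<Longrightarrow> h \<cdot> U \<doteq> h' \<cdot> U"
  by (simp add: vcongr_def left_mult_def congr_rmult)

lemma left_mult_0_congr: "U \<doteq> 0 \<Longrightarrow> h \<cdot> U \<doteq> 0"
  using vcongr_left_mult[of U 0 h] by (simp add: left_mult_def zero_fun_def)

definition nfv :: "('e \<Rightarrow> ('n, 'k) fpoly) \<Rightarrow> 'e \<Rightarrow> ('n, 'k) fpoly" where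
  "nfv U = (\<lambda>e. pbw_normal_form.nf J (L e) (U e))"

definition coef :: "'n expo \<times> 'e \<Rightarrow> ('e \<Rightarrow> ('n, 'k) fpoly) \<Rightarrow> 'k" where
  "coef s U = Poly_Mapping.lookup (nfv U (snd s)) (std_word (fst s))"

text \<open>The monomials of the representative \<open>\<tau>(u)\<close>, and below \<open>lead\<close> is \<open>lec u\<close>.\<close>

definition supp :: "('e \<Rightarrow> ('n, 'k) fpoly) \<Rightarrow> ('n expo \<times> 'e) set" where
  "supp U = {(\<alpha>, e). e \<in> E \<and> \<alpha> \<in> expos (nfv U e)}"

definition lead :: "('e \<Rightarrow> ('n, 'k) fpoly) \<Rightarrow> 'n expo \<times> 'e" where
  "lead U = largest rE (supp U)"

lemma supp_iff: "s \<in> supp U \<longleftrightarrow> snd s \<in> E \<and> coef s U \<noteq> 0"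
  by (cases s) (simp add: supp_def coef_def expos_def)

lemma nfv_congr: "U \<doteq> nfv U"
  unfolding vcongr_def nfv_def using pbw_normal_form.nf_props(2)[OF component] by blast

lemma coef_cong: "\<lbrakk>U \<doteq> W; snd s \<in> E\<rbrakk> \<Longrightarrow> coef s U = coef s W"
  unfolding coef_def nfv_def vcongr_def using pbw_normal_form.nf_cong[OF component] by metis

lemma coef_add: "snd s \<in> E \<Longrightarrow> coef s (U + W) = coef s U + coef s W"
  unfolding coef_def nfv_def by (simp add: pbw_normal_form.nf_add[OF component] lookup_add)

lemma coef_diff: "snd s \<in> E \<Longrightarrow> coef s (U - W) = coef s U - coef s W"
  unfolding coef_def nfv_def by (simp add: pbw_normal_form.nf_diff[OF component] lookup_minus)

lemma coef_scale: "snd s \<in> E \<Longrightarrow> coef s (Poly_Mapping.single [] k \<cdot> U) = k * coef s U"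
  unfolding coef_def nfv_def by (simp add: left_mult_def pbw_normal_form.nf_scale[OF component])

lemma supp_cong: "U \<doteq> W \<Longrightarrow> supp U = supp W"
  using coef_cong[of U W] by (auto simp: supp_iff)

lemma finite_supp: "finite (supp U)"
proof -
  have "supp U \<subseteq> (\<Union>e\<in>E. (\<lambda>\<alpha>. (\<alpha>, e)) ` expos (nfv U e))" by (auto simp: supp_def)
  then show ?thesis by (rule finite_subset) (simp add: finite_E)
qed

lemma nfv_eq_0: "supp U = {} \<Longrightarrow> e \<in> E \<Longrightarrow> nfv U e = 0"
proof -
  assume "supp U = {}" and e: "e \<in> E"
  then have ex: "expos (nfv U e) = {}" by (auto simp: supp_def)
  have "v \<notin> Poly_Mapping.keys (nfv U e)" for v
    using pbw_normal_form.keys_nf[OF component[OF e], of v "U e"] ex by (auto simp: nfv_def)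
  then have "Poly_Mapping.keys (nfv U e) = {}" by blast
  then show "nfv U e = 0" by simp
qed

lemma supp_eq_empty_iff: "supp U = {} \<longleftrightarrow> U \<doteq> 0"
proof
  assume "supp U = {}"
  then have "nfv U \<doteq> 0" using nfv_eq_0 by (simp add: vcongr_def zero_fun_def)
  then show "U \<doteq> 0" using nfv_congr vcongr_trans by blast
next
  assume U: "U \<doteq> 0"
  have "coef s U = 0" if "snd s \<in> E" for s
    using coef_diff[OF that, of 0 0] coef_cong[OF U that] by simp
  then show "supp U = {}" by (auto simp: supp_iff)
qed

lemma supp_subset: "supp U \<subseteq> UNIV \<times> E"
  by (auto simp: supp_def)

lemma lead_in_supp: "\<not> U \<doteq> 0 \<Longrightarrow> lead U \<in> supp U"
  and supp_le_lead: "s \<in> supp U \<Longrightarrow> s \<preceq> lead U"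
  unfolding lead_def
  using largest_in_set[OF module_ord_linear supp_subset finite_supp] supp_eq_empty_iff by blast+

lemma supp_irreducible: "(\<alpha>, e) \<in> supp U \<Longrightarrow> \<alpha> \<notin> L e"
  using pbw_normal_form.expos_nf_irreducible[OF component] by (auto simp: supp_def nfv_def)

lemma supp_add: "supp (U + W) \<subseteq> supp U \<union> supp W"
  by (auto simp: supp_iff coef_add)

lemma supp_diff: "supp (U - W) \<subseteq> supp U \<union> supp W"
  by (auto simp: supp_iff coef_diff)

lemma supp_scale: "supp (Poly_Mapping.single [] k \<cdot> U) \<subseteq> supp U"
  by (auto simp: supp_iff coef_scale)

text \<open>In contrast to \<open>supp\<close>, this depends on the representatives \<open>U e\<close>, which are arbitrary
polynomials.  It is easy to control under left multiplication and bounds \<open>supp\<close> from above.\<close>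

definition word_supp :: "('e \<Rightarrow> ('n, 'k) fpoly) \<Rightarrow> ('n expo \<times> 'e) set" where
  "word_supp U = {(content w, e) | w e. e \<in> E \<and> w \<in> Poly_Mapping.keys (U e)}"

lemma supp_le_word_supp:
  assumes "s \<in> supp U" shows "\<exists>t\<in>word_supp U. s \<preceq> t"
proof -
  obtain \<alpha> e where s: "s = (\<alpha>, e)" "e \<in> E" "\<alpha> \<in> expos (nfv U e)" using assms by (auto simp: supp_def)
  then obtain v where v: "v \<in> Poly_Mapping.keys (U e)" "(\<alpha>, content v) \<in> induced_ordering rE e"
    using pbw_normal_form.expos_nf_bound[OF component] unfolding nfv_def by blast
  then show ?thesis using s by (auto simp: word_supp_def induced_ordering_def)
qed

lemma word_supp_nfv: "word_supp (nfv U) = supp U"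
proof (rule Set.set_eqI)
  fix s
  have "w \<in> Poly_Mapping.keys (nfv U e) \<Longrightarrow> content w \<in> expos (nfv U e)" if "e \<in> E" for w e
    using pbw_normal_form.keys_nf[OF component[OF that], of w "U e"] by (simp add: nfv_def)
  moreover have "\<alpha> \<in> expos (nfv U e) \<Longrightarrow> std_word \<alpha> \<in> Poly_Mapping.keys (nfv U e)" for \<alpha> e
    by simp
  ultimately show "s \<in> word_supp (nfv U) \<longleftrightarrow> s \<in> supp U"
    unfolding word_supp_def supp_def by (auto, metis content_std_word)
qed

lemma word_supp_left_mult:
  "s \<in> word_supp (h \<cdot> U) \<Longrightarrow> \<exists>w\<in>Poly_Mapping.keys h. \<exists>t\<in>word_supp U. s = shift (content w) t"
  unfolding word_supp_def left_mult_def
  by (fastforce dest!: keys_mult_append simp: add.commute)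

text \<open>The multiplier \<open>h\<close> is not normalised, and its words are the same in all components.  In the
component \<open>e'\<close> a word \<open>w\<close> of \<open>h\<close> moves a monomial \<open>x\<^sup>\<beta>(e') \<preceq> lead U\<close> to a
combination of monomials up to \<open>shift (content w) (\<beta>, e')\<close>, and this is
\<open>\<preceq> shift (content w) (lead U)\<close> because the ordering of module monomials is compatible with
shifts.\<close>

lemma supp_left_mult:
  assumes "s \<in> supp (h \<cdot> U)"
  shows "\<exists>w\<in>Poly_Mapping.keys h. s \<preceq> shift (content w) (lead U)"
proof -
  have "s \<in> supp (h \<cdot> nfv U)" using assms supp_cong[OF vcongr_left_mult[OF nfv_congr]] by blast
  then obtain t where t: "t \<in> word_supp (h \<cdot> nfv U)" "s \<preceq> t" using supp_le_word_supp by blast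
  then obtain w u where w: "w \<in> Poly_Mapping.keys h" "u \<in> supp U" "t = shift (content w) u"
    using word_supp_left_mult word_supp_nfv by blast
  then have "t \<preceq> shift (content w) (lead U)" using supp_le_lead shift_le by blast
  then show ?thesis using t(2) w(1) mon_le_trans by blast
qed

text \<open>Multiplying the normal form of \<open>U e\<close> by \<open>w\<close> gives one word of content \<open>\<alpha> + content w\<close>, all
others being smaller, and its content is irreducible.\<close>

lemma lead_left_mult:
  assumes U: "\<not> U \<doteq> 0" and lead: "lead U = (\<alpha>, e)" and irr: "\<alpha> + content w \<notin> L e"
  shows "(\<alpha> + content w, e) \<in> supp (Poly_Mapping.single w 1 \<cdot> U)"
proof -
  have "(\<alpha>, e) \<in> supp U" using lead_in_supp[OF U] lead by simp
  then have e: "e \<in> E" and \<alpha>: "\<alpha> \<in> expos (nfv U e)" by (auto simp: supp_def)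
  interpret P: pbw_normal_form J "induced_ordering rE e" "L e" using component[OF e] .
  define f where "f = Poly_Mapping.single w 1 * nfv U e"
  have "content (w @ std_word \<alpha>) \<in> expos (P.nf f)"
  proof (rule P.nf_top)
    show "w @ std_word \<alpha> \<in> Poly_Mapping.keys f"
      using \<alpha> by (simp add: f_def in_keys_iff lookup_single_mult expos_def)
    show "content (w @ std_word \<alpha>) \<notin> L e" using irr by (simp add: add.commute)
    fix v assume v: "v \<in> Poly_Mapping.keys f - {w @ std_word \<alpha>}"
    then obtain u where u: "v = w @ u" "u \<in> Poly_Mapping.keys (nfv U e)"
      using keys_single_mult unfolding f_def by blast
    then obtain \<beta> where \<beta>: "u = std_word \<beta>" "\<beta> \<in> expos (nfv U e)"
      using P.keys_nf unfolding nfv_def by blast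
    then have "(\<beta>, e) \<in> supp U" using e by (simp add: supp_def)
    then have "(\<beta>, \<alpha>) \<in> induced_ordering rE e" using supp_le_lead lead by (fastforce simp: induced_ordering_def)
    moreover have "\<beta> \<noteq> \<alpha>" using v u \<beta> by auto
    ultimately have "(\<beta> + content w, \<alpha> + content w) \<in> induced_ordering rE e - Id"
      by (intro P.r_order(5)) simp
    then show "(content v, content (w @ std_word \<alpha>)) \<in> induced_ordering rE e - Id"
      using u \<beta> by (simp add: add.commute)
  qed
  then have "(\<alpha> + content w, e) \<in> supp (Poly_Mapping.single w 1 \<cdot> nfv U)"
    using e by (simp add: supp_def nfv_def f_def left_mult_def add.commute)
  then show ?thesis using supp_cong[OF vcongr_left_mult[OF nfv_congr]] by blast
qed

end

section \<open>Representations bounded by a set of monomials\<close>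

lemma left_mult_0_left [simp]: "0 \<cdot> U = 0"
  by (simp add: left_mult_def zero_fun_def)

lemma left_mult_0_right [simp]: "h \<cdot> 0 = 0"
  by (simp add: left_mult_def zero_fun_def)

lemma left_mult_add_left: "(h + h') \<cdot> U = h \<cdot> U + h' \<cdot> U"
  by (simp add: left_mult_def distrib_right fun_eq_iff)

lemma left_mult_sum: "h \<cdot> sum f X = (\<Sum>x\<in>X. h \<cdot> f x)"
  by (induction X rule: infinite_finite_induct)
    (simp_all only: sum.infinite sum.empty sum.insert left_mult_0_right left_mult_add not_False_eq_True)

lemma left_mult_sum_left: "sum f X \<cdot> U = (\<Sum>x\<in>X. f x \<cdot> U)"
  by (induction X rule: infinite_finite_induct) (simp_all add: left_mult_add_left)

locale pbw_generators = pbw_free_module J E rE L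
  for J :: "('n::{finite,linorder}, 'k::field) fpoly set" and E :: "'e set" and rE L +
  fixes G :: "'g set" and V :: "'g \<Rightarrow> 'e \<Rightarrow> ('n, 'k) fpoly"
  assumes finite_G: "finite G"
begin

text \<open>A representation whose terms have their expected leading monomials in \<open>D\<close>.  For the
\<open>D\<close> of all monomials up to \<open>lead U\<close> it is a standard representation.  Generators that vanish
have no leading monomial, so their coefficients are unrestricted.\<close>

definition repr_within :: "('n expo \<times> 'e) set \<Rightarrow> ('e \<Rightarrow> ('n, 'k) fpoly) \<Rightarrow> bool" where
  "repr_within D U \<longleftrightarrow> (\<exists>h. U \<doteq> (\<Sum>g\<in>G. h g \<cdot> V g) \<and>
     (\<forall>g\<in>G. \<not> V g \<doteq> 0 \<longrightarrow> (\<forall>w\<in>Poly_Mapping.keys (h g). shift (content w) (lead (V g)) \<in> D)))"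

lemma repr_cong: "\<lbrakk>repr_within D W; U \<doteq> W\<rbrakk> \<Longrightarrow> repr_within D U"
  unfolding repr_within_def using vcongr_trans by blast

lemma repr_mono: "\<lbrakk>repr_within D U; D \<subseteq> D'\<rbrakk> \<Longrightarrow> repr_within D' U"
  unfolding repr_within_def by (meson subsetD)

lemma repr_0: "repr_within D 0"
  unfolding repr_within_def by (rule exI[of _ "\<lambda>_. 0"]) simp

lemma repr_add:
  assumes "repr_within D U" "repr_within D W" shows "repr_within D (U + W)"
proof -
  obtain h where h: "U \<doteq> (\<Sum>g\<in>G. h g \<cdot> V g)"
    "\<forall>g\<in>G. \<not> V g \<doteq> 0 \<longrightarrow> (\<forall>w\<in>Poly_Mapping.keys (h g). shift (content w) (lead (V g)) \<in> D)"
    using assms(1) unfolding repr_within_def by blast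
  obtain h' where h': "W \<doteq> (\<Sum>g\<in>G. h' g \<cdot> V g)"
    "\<forall>g\<in>G. \<not> V g \<doteq> 0 \<longrightarrow> (\<forall>w\<in>Poly_Mapping.keys (h' g). shift (content w) (lead (V g)) \<in> D)"
    using assms(2) unfolding repr_within_def by blast
  have "U + W \<doteq> (\<Sum>g\<in>G. (h g + h' g) \<cdot> V g)"
    using vcongr_add[OF h(1) h'(1)] by (simp add: left_mult_add_left sum.distrib)
  moreover have "shift (content w) (lead (V g)) \<in> D"
    if "g \<in> G" "\<not> V g \<doteq> 0" "w \<in> Poly_Mapping.keys (h g + h' g)" for g w
  proof -
    have "w \<in> Poly_Mapping.keys (h g) \<union> Poly_Mapping.keys (h' g)"
      using that(3) Poly_Mapping.keys_add by (rule subsetD[rotated])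
    then show ?thesis using h(2) h'(2) that(1,2) by auto
  qed
  ultimately show ?thesis unfolding repr_within_def by (intro exI[of _ "\<lambda>g. h g + h' g"]) simp
qed

lemma repr_left_mult:
  assumes "repr_within D U"
    and D: "\<And>w s. \<lbrakk>w \<in> Poly_Mapping.keys f; s \<in> D\<rbrakk> \<Longrightarrow> shift (content w) s \<in> D'"
  shows "repr_within D' (f \<cdot> U)"
proof -
  obtain h where h: "U \<doteq> (\<Sum>g\<in>G. h g \<cdot> V g)"
    "\<forall>g\<in>G. \<not> V g \<doteq> 0 \<longrightarrow> (\<forall>w\<in>Poly_Mapping.keys (h g). shift (content w) (lead (V g)) \<in> D)"
    using assms(1) unfolding repr_within_def by blast
  have "f \<cdot> U \<doteq> (\<Sum>g\<in>G. (f * h g) \<cdot> V g)"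
    using vcongr_left_mult[OF h(1), of f] by (simp add: left_mult_sum)
  moreover have "shift (content w) (lead (V g)) \<in> D'"
    if "g \<in> G" "\<not> V g \<doteq> 0" "w \<in> Poly_Mapping.keys (f * h g)" for g w
  proof -
    obtain u v where uv: "u \<in> Poly_Mapping.keys f" "v \<in> Poly_Mapping.keys (h g)" "w = u @ v"
      using keys_mult_append \<open>w \<in> _\<close> by blast
    then show ?thesis using D[OF uv(1)] h(2) that(1,2) by (metis content_append shift_shift)
  qed
  ultimately show ?thesis unfolding repr_within_def by (intro exI[of _ "\<lambda>g. f * h g"]) simp
qed

lemma shift_0 [simp]: "shift 0 s = s"
  by (simp add: shift_def)

lemma repr_scale: "repr_within D U \<Longrightarrow> repr_within D (Poly_Mapping.single [] k \<cdot> U)"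
  by (erule repr_left_mult) (simp split: if_splits)

lemma repr_diff: "\<lbrakk>repr_within D U; repr_within D W\<rbrakk> \<Longrightarrow> repr_within D (U - W)"
proof -
  assume "repr_within D U" "repr_within D W"
  then have "repr_within D (U + Poly_Mapping.single [] (- 1) \<cdot> W)" by (intro repr_add repr_scale)
  moreover have "U + Poly_Mapping.single [] (- 1) \<cdot> W = U - W"
    by (simp add: left_mult_def fun_eq_iff single_uminus)
  ultimately show "repr_within D (U - W)" by simp
qed

lemma repr_generator:
  assumes "g \<in> G" "\<And>w. w \<in> Poly_Mapping.keys f \<Longrightarrow> shift (content w) (lead (V g)) \<in> D"
  shows "repr_within D (f \<cdot> V g)"
proof -
  define h where "h = (\<lambda>g'. if g' = g then f else 0)"
  have "h g' \<cdot> V g' = (if g' = g then f \<cdot> V g else 0)" for g' by (simp add: h_def)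
  then have "f \<cdot> V g \<doteq> (\<Sum>g'\<in>G. h g' \<cdot> V g')" using assms(1) finite_G by simp
  moreover have "\<forall>g'\<in>G. \<not> V g' \<doteq> 0 \<longrightarrow> (\<forall>w\<in>Poly_Mapping.keys (h g'). shift (content w) (lead (V g')) \<in> D)"
    using assms(2) by (simp add: h_def)
  ultimately show ?thesis unfolding repr_within_def by blast
qed

text \<open>A vector with a representation within \<open>D\<close> is a sum of terms \<open>c w g\<close>, each of which satisfies
the bound.\<close>

lemma repr_induct [consumes 1, case_names congr zero add monomial]:
  assumes "repr_within D U"
    and congr: "\<And>U W. \<lbrakk>U \<doteq> W; Q W\<rbrakk> \<Longrightarrow> Q U"
    and zero: "Q 0"
    and add: "\<And>U W. \<lbrakk>Q U; Q W\<rbrakk> \<Longrightarrow> Q (U + W)"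
    and monomial: "\<And>g w c. \<lbrakk>g \<in> G; \<not> V g \<doteq> 0; shift (content w) (lead (V g)) \<in> D\<rbrakk>
        \<Longrightarrow> Q (Poly_Mapping.single w c \<cdot> V g)"
  shows "Q U"
proof -
  obtain h where h: "U \<doteq> (\<Sum>g\<in>G. h g \<cdot> V g)"
    "\<forall>g\<in>G. \<not> V g \<doteq> 0 \<longrightarrow> (\<forall>w\<in>Poly_Mapping.keys (h g). shift (content w) (lead (V g)) \<in> D)"
    using assms(1) unfolding repr_within_def by blast
  have sum: "Q (sum f X)" if "\<And>x. x \<in> X \<Longrightarrow> Q (f x)" for f :: "'n list \<Rightarrow> _" and X
    using that by (induction X rule: infinite_finite_induct) (auto intro: zero add)
  have "Q (h g \<cdot> V g)" if g: "g \<in> G" for g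
  proof (cases "V g \<doteq> 0")
    case True
    then show ?thesis using left_mult_0_congr congr zero by blast
  next
    case False
    have "h g \<cdot> V g = (\<Sum>w\<in>Poly_Mapping.keys (h g). Poly_Mapping.single w (Poly_Mapping.lookup (h g) w) \<cdot> V g)"
      by (simp flip: left_mult_sum_left fpoly_eq_sum)
    moreover have "Q \<dots>" using h(2) g False by (intro sum monomial) auto
    ultimately show ?thesis by simp
  qed
  then have "Q (\<Sum>g\<in>G. h g \<cdot> V g)"
    by (induction rule: infinite_finite_induct) (auto intro: zero add)
  then show ?thesis using congr h(1) by blast
qed

lemma repr_supp:
  assumes "repr_within D U" and D: "D \<subseteq> UNIV \<times> E" "\<And>s t. \<lbrakk>t \<in> D; s \<preceq> t\<rbrakk> \<Longrightarrow> s \<in> D"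
  shows "supp U \<subseteq> D"
  using assms(1)
proof (induction rule: repr_induct)
  case (congr U W)
  then show ?case using supp_cong by blast
next
  case zero
  then show ?case using supp_eq_empty_iff[of 0] vcongr_refl[of 0] by blast
next
  case (add U W)
  then show ?case using supp_add by blast
next
  case (monomial g w c)
  then show ?case using supp_left_mult D(2) by (fastforce split: if_splits)
qed

lemma repr_upto_supp: "repr_within (upto_mon t) U \<Longrightarrow> supp U \<subseteq> upto_mon t"
  by (erule repr_supp) (use rE_order(3) mon_le_trans in auto)

lemma repr_below_supp: "repr_within (below_mon t) U \<Longrightarrow> supp U \<subseteq> below_mon t"
  by (erule repr_supp) (use rE_order(3) mon_le_less_trans in auto)

text \<open>Only finitely many words occur in a representation, so one of the monomials they lead to is
the largest.  If there is none, the vector is zero.\<close>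

lemma repr_upto_some:
  assumes "repr_within D U" "D \<subseteq> UNIV \<times> E" "\<not> U \<doteq> 0"
  shows "\<exists>t\<in>D. repr_within (upto_mon t) U"
proof -
  have "U \<doteq> 0 \<or> (\<exists>t\<in>D. repr_within (upto_mon t) U)"
    using assms(1)
  proof (induction rule: repr_induct)
    case (congr U W)
    then show ?case using vcongr_trans repr_cong by blast
  next
    case (add U W)
    show ?case
    proof (cases "U \<doteq> 0 \<or> W \<doteq> 0")
      case True
      then have "U + W \<doteq> W \<or> U + W \<doteq> U"
        using vcongr_add[of U 0 W W] vcongr_add[of U U W 0] by auto
      then show ?thesis using add vcongr_trans repr_cong by blast
    next
      case False
      then obtain s t where st: "s \<in> D" "t \<in> D" "repr_within (upto_mon s) U" "repr_within (upto_mon t) W"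
        using add by blast
      define m where "m = largest rE {s, t}"
      have m: "m \<in> {s, t}" "s \<preceq> m" "t \<preceq> m"
        unfolding m_def using largest_in_set[OF module_ord_linear, of "{s, t}"] st assms(2) by blast+
      have "repr_within (upto_mon m) U" "repr_within (upto_mon m) W"
        using st(3,4) m(2,3) mon_le_trans by (blast intro: repr_mono)+
      then show ?thesis using repr_add m(1) st(1,2) by blast
    qed
  next
    case (monomial g w c)
    have "repr_within (upto_mon (shift (content w) (lead (V g)))) (Poly_Mapping.single w c \<cdot> V g)"
      using monomial assms(2) by (intro repr_generator) (auto split: if_splits intro!: mon_le_refl)
    then show ?case using monomial by blast
  qed simp
  then show ?thesis using assms(3) by blast
qed

text \<open>The lower terms in the congruence between the two words are lower with respect to the
ordering of the leading component of \<open>g\<close>, as a coefficient of \<open>g\<close> requires.\<close>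

lemma same_content_repr:
  assumes g: "g \<in> G" "\<not> V g \<doteq> 0" and "content v = content w"
  shows "\<exists>k. k \<noteq> 0 \<and> repr_within (below_mon (shift (content w) (lead (V g))))
           (Poly_Mapping.single v 1 \<cdot> V g - Poly_Mapping.single w k \<cdot> V g)"
proof -
  define e where "e = snd (lead (V g))"
  have e: "e \<in> E" using lead_in_supp[OF g(2)] by (simp add: supp_iff e_def)
  interpret P: pbw_normal_form J "induced_ordering rE e" "L e" using component[OF e] .
  obtain k f where k: "k \<noteq> 0" "content_below (induced_ordering rE e) (content w) f"
    "Poly_Mapping.single v 1 \<approx> Poly_Mapping.single w k + f"
    using P.same_content_congr[OF assms(3)] by blast
  have "Poly_Mapping.single v 1 \<cdot> V g - Poly_Mapping.single w k \<cdot> V g \<doteq>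
      (Poly_Mapping.single w k + f) \<cdot> V g - Poly_Mapping.single w k \<cdot> V g"
    using k(3) by (intro vcongr_diff vcongr_left_mult_left) simp_all
  also have "\<dots> = f \<cdot> V g" by (simp add: left_mult_add_left)
  finally have "Poly_Mapping.single v 1 \<cdot> V g - Poly_Mapping.single w k \<cdot> V g \<doteq> f \<cdot> V g" .
  moreover have "repr_within (below_mon (shift (content w) (lead (V g)))) (f \<cdot> V g)"
    using g(1) k(2) shift_less_left unfolding content_below_def e_def
    by (intro repr_generator) auto
  ultimately show ?thesis using k(1) repr_cong by blast
qed

end

section \<open>The Buchberger criterion for vectors of polynomials\<close>

context pbw_generators
begin

definition is_groebner :: bool where
  "is_groebner \<longleftrightarrow> (\<forall>U. repr_within (UNIV \<times> E) U \<longrightarrow> \<not> U \<doteq> 0 \<longrightarrow> repr_within (upto_mon (lead U)) U)"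

lemma repr_shift_below:
  assumes "repr_within (below_mon s) U"
  shows "repr_within (below_mon (shift (content w) s)) (Poly_Mapping.single w c \<cdot> U)"
  using assms by (rule repr_left_mult) (use shift_less in \<open>auto split: if_splits\<close>)

lemma repr_diff_trans:
  "\<lbrakk>repr_within D (U - W); repr_within D (W - X)\<rbrakk> \<Longrightarrow> repr_within D (U - X)"
  using repr_add[of D "U - W" "W - X"] by simp

text \<open>With \<open>b = sup \<alpha> \<beta>\<close>, the word \<open>w\<close> has the same content as the concatenation of the standard
words for \<open>\<alpha> + content w - b\<close> and \<open>b - \<alpha>\<close>.  So up to lower terms \<open>w g\<close> is a multiple of
\<open>x\<^sup>b\<^sup>-\<^sup>\<alpha> g\<close>, for which \<open>red\<close> provides a representation.\<close>

lemma reducible_monomial: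
  assumes g: "g \<in> G" "\<not> V g \<doteq> 0" "lead (V g) = (\<alpha>, e)"
    and le: "\<beta> \<le> \<alpha> + content w"
    and red: "repr_within (below_mon (sup \<alpha> \<beta>, e)) (Poly_Mapping.single (std_word (sup \<alpha> \<beta> - \<alpha>)) 1 \<cdot> V g)"
  shows "repr_within (below_mon (\<alpha> + content w, e)) (Poly_Mapping.single w c \<cdot> V g)"
proof -
  define \<epsilon> where "\<epsilon> = \<alpha> + content w - sup \<alpha> \<beta>"
  define v where "v = std_word \<epsilon> @ std_word (sup \<alpha> \<beta> - \<alpha>)"
  have le': "sup \<alpha> \<beta> \<le> \<alpha> + content w" using le by (simp add: le_fun_def)
  then have top: "sup \<alpha> \<beta> + \<epsilon> = \<alpha> + content w"
    unfolding \<epsilon>_def by (auto simp: fun_eq_iff le_fun_def)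
  have "content v = content w"
    using le' by (auto simp: v_def \<epsilon>_def fun_eq_iff le_fun_def sup_nat_def)
  then obtain k where k: "repr_within (below_mon (\<alpha> + content w, e))
      (Poly_Mapping.single w 1 \<cdot> V g - Poly_Mapping.single v k \<cdot> V g)"
    using same_content_repr[OF g(1,2), of w v] g(3) by auto
  from repr_shift_below[OF red, of "std_word \<epsilon>" k]
  have "repr_within (below_mon (\<alpha> + content w, e)) (Poly_Mapping.single v k \<cdot> V g)"
    by (simp add: top v_def)
  from repr_add[OF k this] have "repr_within (below_mon (\<alpha> + content w, e)) (Poly_Mapping.single w 1 \<cdot> V g)"
    by simp
  from repr_scale[OF this, of c] show ?thesis by simp
qed

text \<open>With \<open>b = sup \<alpha> \<alpha>'\<close> and \<open>\<epsilon> = \<alpha> + content w - b\<close>, the terms \<open>w g\<close> and \<open>w' g'\<close> are, up to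
nonzero scalars and lower terms, \<open>x\<^sup>\<epsilon> x\<^sup>b\<^sup>-\<^sup>\<alpha> g\<close> and \<open>x\<^sup>\<epsilon> x\<^sup>b\<^sup>-\<^sup>\<alpha>\<^sup>' g'\<close>.  A combination of these is
\<open>x\<^sup>\<epsilon>\<close> times the combination that \<open>red\<close> represents below \<open>b\<close>.\<close>

lemma proportional_monomials:
  assumes g: "g \<in> G" "\<not> V g \<doteq> 0" "lead (V g) = (\<alpha>, e)"
    and g': "g' \<in> G" "\<not> V g' \<doteq> 0" "lead (V g') = (\<alpha>', e)"
    and eq: "\<alpha> + content w = \<alpha>' + content w'"
    and k: "k \<noteq> 0"
    and red: "repr_within (below_mon (sup \<alpha> \<alpha>', e))
      (Poly_Mapping.single (std_word (sup \<alpha> \<alpha>' - \<alpha>)) k \<cdot> V g -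
       Poly_Mapping.single (std_word (sup \<alpha> \<alpha>' - \<alpha>')) k' \<cdot> V g')"
  shows "\<exists>c'. repr_within (below_mon (\<alpha> + content w, e))
      (Poly_Mapping.single w c \<cdot> V g - Poly_Mapping.single w' c' \<cdot> V g')"
proof -
  define t where "t = (\<alpha> + content w, e)"
  define \<epsilon> where "\<epsilon> = \<alpha> + content w - sup \<alpha> \<alpha>'"
  define v where "v = std_word \<epsilon> @ std_word (sup \<alpha> \<alpha>' - \<alpha>)"
  define v' where "v' = std_word \<epsilon> @ std_word (sup \<alpha> \<alpha>' - \<alpha>')"
  have "\<alpha>' \<le> \<alpha> + content w" unfolding eq by (simp add: le_fun_def)
  then have le: "sup \<alpha> \<alpha>' \<le> \<alpha> + content w" by (simp add: le_fun_def)
  then have top: "sup \<alpha> \<alpha>' + \<epsilon> = \<alpha> + content w"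
    unfolding \<epsilon>_def by (auto simp: fun_eq_iff le_fun_def)
  have le2: "sup \<alpha> \<alpha>' \<le> \<alpha>' + content w'" using le eq by simp
  have v: "content v = content w"
    using le by (auto simp: v_def \<epsilon>_def fun_eq_iff le_fun_def sup_nat_def)
  have v': "content v' = content w'"
    using le2 unfolding v'_def \<epsilon>_def eq by (auto simp: fun_eq_iff le_fun_def sup_nat_def)
  obtain a where a: "repr_within (below_mon t) (Poly_Mapping.single w 1 \<cdot> V g - Poly_Mapping.single v a \<cdot> V g)"
    using same_content_repr[OF g(1,2), of w v] g(3) v unfolding t_def by auto
  obtain b where b: "repr_within (below_mon t) (Poly_Mapping.single v' 1 \<cdot> V g' - Poly_Mapping.single w' b \<cdot> V g')"
    using same_content_repr[OF g'(1,2), of v' w'] g'(3) v' eq unfolding t_def by auto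
  from repr_shift_below[OF red, of "std_word \<epsilon>" "a / k"] k
  have m: "repr_within (below_mon t) (Poly_Mapping.single v a \<cdot> V g - Poly_Mapping.single v' (a / k * k') \<cdot> V g')"
    by (simp add: t_def top left_mult_diff v_def v'_def)
  from repr_scale[OF b, of "a / k * k'"]
  have "repr_within (below_mon t) (Poly_Mapping.single v' (a / k * k') \<cdot> V g' - Poly_Mapping.single w' (a / k * k' * b) \<cdot> V g')"
    by (simp add: left_mult_diff)
  from repr_diff_trans[OF a repr_diff_trans[OF m this]]
  have "repr_within (below_mon t) (Poly_Mapping.single w 1 \<cdot> V g - Poly_Mapping.single w' (a / k * k' * b) \<cdot> V g')" .
  from repr_scale[OF this, of c] show ?thesis
    unfolding t_def by (auto simp: left_mult_diff)
qed

text \<open>If the bound \<open>t\<close> is not attained by \<open>U\<close> itself, the terms that lead to \<open>t\<close> can be rewritten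
below \<open>t\<close>: for reducible \<open>t\<close> each term separately, and for irreducible \<open>t\<close> because they are all
proportional to one term, whose total coefficient must vanish.  Here \<open>L0 e\<close> stands for the
leading exponents of \<open>I\<^sub>e\<close>, and the representations that the hypotheses provide are those of the
two kinds of s-polynomials.\<close>

lemma lower_top_term:
  assumes L0: "\<And>e. e \<in> E \<Longrightarrow> L e = {\<beta> + \<gamma> | \<beta> \<gamma>. \<beta> \<in> L0 e}"
    and pairs: "\<And>g g' \<alpha> \<alpha>' e. \<lbrakk>g \<in> G; \<not> V g \<doteq> 0; g' \<in> G; \<not> V g' \<doteq> 0;
        lead (V g) = (\<alpha>, e); lead (V g') = (\<alpha>', e); sup \<alpha> \<alpha>' \<notin> L e\<rbrakk> \<Longrightarrow>
      \<exists>k k'. k \<noteq> 0 \<and> repr_within (below_mon (sup \<alpha> \<alpha>', e))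
        (Poly_Mapping.single (std_word (sup \<alpha> \<alpha>' - \<alpha>)) k \<cdot> V g -
         Poly_Mapping.single (std_word (sup \<alpha> \<alpha>' - \<alpha>')) k' \<cdot> V g')"
    and relations: "\<And>g \<alpha> e \<beta>. \<lbrakk>g \<in> G; \<not> V g \<doteq> 0; lead (V g) = (\<alpha>, e); \<beta> \<in> L0 e\<rbrakk> \<Longrightarrow>
      repr_within (below_mon (sup \<alpha> \<beta>, e)) (Poly_Mapping.single (std_word (sup \<alpha> \<beta> - \<alpha>)) 1 \<cdot> V g)"
    and U: "repr_within (upto_mon t) U" "t \<notin> supp U" and t: "snd t \<in> E"
  shows "repr_within (below_mon t) U"
proof -
  obtain \<tau> e where te: "t = (\<tau>, e)" by (cases t)
  have e: "e \<in> E" using t te by simp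
  have lower: "repr_within (below_mon t) (Poly_Mapping.single w c \<cdot> V g)"
    if "g \<in> G" "shift (content w) (lead (V g)) \<prec> t" for g w c
    using that by (intro repr_generator) (auto split: if_splits)
  show ?thesis
  proof (cases "\<tau> \<in> L e")
    case True
    then obtain \<beta> \<gamma> where \<beta>: "\<beta> \<in> L0 e" "\<tau> = \<beta> + \<gamma>" using L0[OF e] by blast
    show ?thesis using U(1)
    proof (induction rule: repr_induct)
      case (monomial g w c)
      show ?case
      proof (cases "shift (content w) (lead (V g)) = t")
        case eq: True
        obtain \<alpha> where \<alpha>: "lead (V g) = (\<alpha>, e)" "\<tau> = \<alpha> + content w"
          using eq te by (cases "lead (V g)") auto
        have "\<beta> \<le> \<alpha> + content w" using \<beta>(2) \<alpha>(2) expo_le_iff_add by metis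
        then show ?thesis
          using reducible_monomial[OF monomial(1,2) \<alpha>(1)] relations[OF monomial(1,2) \<alpha>(1) \<beta>(1)]
          unfolding te \<alpha>(2) by blast
      qed (use monomial lower in auto)
    qed (use repr_cong repr_0 repr_add in blast)+
  next
    case False
    show ?thesis
    proof (cases "\<exists>g\<in>G. \<not> V g \<doteq> 0 \<and> (\<exists>w. shift (content w) (lead (V g)) = t)")
      case no_top: False
      show ?thesis using U(1)
      proof (induction rule: repr_induct)
        case (monomial g w c)
        then show ?case using no_top lower by auto
      qed (use repr_cong repr_0 repr_add in blast)+
    next
      case True
      then obtain g0 w0 where g0: "g0 \<in> G" "\<not> V g0 \<doteq> 0" "shift (content w0) (lead (V g0)) = t" by blast
      obtain \<alpha>0 where \<alpha>0: "lead (V g0) = (\<alpha>0, e)" "\<tau> = \<alpha>0 + content w0"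
        using g0(3) te by (cases "lead (V g0)") auto
      have "\<exists>k. repr_within (below_mon t) (U - Poly_Mapping.single w0 k \<cdot> V g0)"
        using U(1)
      proof (induction rule: repr_induct)
        case (congr U W)
        then show ?case using repr_cong vcongr_diff[OF _ vcongr_refl] by blast
      next
        case zero
        have "0 - Poly_Mapping.single w0 0 \<cdot> V g0 = 0" by (simp add: fun_eq_iff)
        then show ?case using repr_0 by metis
      next
        case (add U W)
        then obtain k l where "repr_within (below_mon t) (U - Poly_Mapping.single w0 k \<cdot> V g0)"
          "repr_within (below_mon t) (W - Poly_Mapping.single w0 l \<cdot> V g0)" by blast
        moreover have "U + W - Poly_Mapping.single w0 (k + l) \<cdot> V g0 =
            (U - Poly_Mapping.single w0 k \<cdot> V g0) + (W - Poly_Mapping.single w0 l \<cdot> V g0)"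
          by (simp add: fun_eq_iff single_add left_mult_add_left)
        ultimately show ?case using repr_add by metis
      next
        case (monomial g w c)
        show ?case
        proof (cases "shift (content w) (lead (V g)) = t")
          case eq: True
          obtain \<alpha> where \<alpha>: "lead (V g) = (\<alpha>, e)" "\<tau> = \<alpha> + content w"
            using eq te by (cases "lead (V g)") auto
          have "sup \<alpha> \<alpha>0 \<le> \<tau>" using \<alpha>(2) \<alpha>0(2) expo_le_iff_add by (metis le_sup_iff)
          then have "sup \<alpha> \<alpha>0 \<notin> L e" using False L_add[OF e] by (auto simp: expo_le_iff_add)
          from pairs[OF monomial(1,2) g0(1,2) \<alpha>(1) \<alpha>0(1) this]
          obtain k k' where k: "k \<noteq> 0" and red: "repr_within (below_mon (sup \<alpha> \<alpha>0, e))
              (Poly_Mapping.single (std_word (sup \<alpha> \<alpha>0 - \<alpha>)) k \<cdot> V g -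
               Poly_Mapping.single (std_word (sup \<alpha> \<alpha>0 - \<alpha>0)) k' \<cdot> V g0)" by blast
          have "\<alpha> + content w = \<alpha>0 + content w0" using \<alpha>(2) \<alpha>0(2) by simp
          from proportional_monomials[OF monomial(1,2) \<alpha>(1) g0(1,2) \<alpha>0(1) this k red]
          show ?thesis unfolding te \<alpha>(2) .
        next
          case False
          then show ?thesis using monomial lower by (intro exI[of _ 0]) auto
        qed
      qed
      then obtain k where k: "repr_within (below_mon t) (U - Poly_Mapping.single w0 k \<cdot> V g0)" by blast
      then have "t \<notin> supp (U - Poly_Mapping.single w0 k \<cdot> V g0)" using repr_below_supp mon_less_irrefl by blast
      \<comment> \<open>The coefficient of \<open>t\<close> in \<open>U\<close> is \<open>0\<close>, but in the remaining term it is not.\<close>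
      then have "coef t (U - Poly_Mapping.single [] k \<cdot> Poly_Mapping.single w0 1 \<cdot> V g0) = 0"
        using t by (simp add: supp_iff)
      then have "coef t U = k * coef t (Poly_Mapping.single w0 1 \<cdot> V g0)"
        by (simp only: coef_diff[OF t] coef_scale[OF t] right_minus_eq)
      moreover have "coef t U = 0" using U(2) t by (simp add: supp_iff)
      moreover have "t \<in> supp (Poly_Mapping.single w0 1 \<cdot> V g0)"
        using lead_left_mult[OF g0(2) \<alpha>0(1)] False unfolding te \<alpha>0(2) by blast
      then have "coef t (Poly_Mapping.single w0 1 \<cdot> V g0) \<noteq> 0" by (simp add: supp_iff)
      ultimately have "k = 0" by simp
      then show ?thesis using k by simp
    qed
  qed
qed

text \<open>Induction on the bound \<open>t\<close> of a representation of \<open>U\<close>: a bound that is attained by \<open>U\<close> is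
its leading monomial, and any other bound can be lowered.\<close>

lemma buchberger:
  assumes L0: "\<And>e. e \<in> E \<Longrightarrow> L e = {\<beta> + \<gamma> | \<beta> \<gamma>. \<beta> \<in> L0 e}"
    and pairs: "\<And>g g' \<alpha> \<alpha>' e. \<lbrakk>g \<in> G; \<not> V g \<doteq> 0; g' \<in> G; \<not> V g' \<doteq> 0;
        lead (V g) = (\<alpha>, e); lead (V g') = (\<alpha>', e); sup \<alpha> \<alpha>' \<notin> L e\<rbrakk> \<Longrightarrow>
      \<exists>k k'. k \<noteq> 0 \<and> repr_within (below_mon (sup \<alpha> \<alpha>', e))
        (Poly_Mapping.single (std_word (sup \<alpha> \<alpha>' - \<alpha>)) k \<cdot> V g -
         Poly_Mapping.single (std_word (sup \<alpha> \<alpha>' - \<alpha>')) k' \<cdot> V g')"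
    and relations: "\<And>g \<alpha> e \<beta>. \<lbrakk>g \<in> G; \<not> V g \<doteq> 0; lead (V g) = (\<alpha>, e); \<beta> \<in> L0 e\<rbrakk> \<Longrightarrow>
      repr_within (below_mon (sup \<alpha> \<beta>, e)) (Poly_Mapping.single (std_word (sup \<alpha> \<beta> - \<alpha>)) 1 \<cdot> V g)"
  shows is_groebner
  unfolding is_groebner_def
proof (intro allI impI)
  fix U assume U: "repr_within (UNIV \<times> E) U" "\<not> U \<doteq> 0"
  then obtain t where "repr_within (upto_mon t) U" using repr_upto_some by blast
  then show "repr_within (upto_mon (lead U)) U"
  proof (induction t rule: wf_induct_rule[OF wf_rE])
    case (1 t)
    show ?case
    proof (cases "t \<in> supp U")
      case True
      have "lead U \<preceq> t" using repr_upto_supp[OF 1(2)] lead_in_supp[OF U(2)] by blast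
      moreover have "t \<preceq> lead U" using True by (rule supp_le_lead)
      ultimately have "lead U = t" using rE_order(2) by (simp add: antisymD)
      then show ?thesis using 1(2) by simp
    next
      case False
      have t: "snd t \<in> E" using repr_upto_supp[OF 1(2)] lead_in_supp[OF U(2)] snd_in_E by blast
      have "repr_within (below_mon t) U" by (rule lower_top_term[OF L0 pairs relations 1(2) False t])
      then obtain s where "s \<prec> t" "repr_within (upto_mon s) U"
        using repr_upto_some[of "below_mon t" U] rE_order(3) U(2) by blast
      then show ?thesis using 1(1) by blast
    qed
  qed
qed

definition lead_multiples :: "('n expo \<times> 'e) set" where
  "lead_multiples = {shift \<gamma> (lead (V g)) | \<gamma> g. g \<in> G \<and> \<not> V g \<doteq> 0}"

text \<open>If no term of the representation reached \<open>lead U\<close>, the representation would lie below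
\<open>lead U\<close>, and so would \<open>U\<close>.\<close>

lemma lead_of_repr:
  assumes "repr_within (upto_mon (lead U)) U" "\<not> U \<doteq> 0"
  shows "lead U \<in> lead_multiples"
proof (rule ccontr)
  assume nin: "lead U \<notin> lead_multiples"
  have no: "shift \<gamma> (lead (V g)) \<noteq> lead U" if "g \<in> G" "\<not> V g \<doteq> 0" for \<gamma> g
  proof
    assume "shift \<gamma> (lead (V g)) = lead U"
    then have "lead U \<in> lead_multiples" using that unfolding lead_multiples_def by (auto intro: sym)
    then show False using nin by simp
  qed
  define t where "t = lead U"
  have "repr_within (below_mon t) U" using assms(1)[folded t_def]
  proof (induction rule: repr_induct)
    case (monomial g w c)
    then show ?case using no unfolding t_def by (intro repr_generator) (auto split: if_splits)
  qed (use repr_cong repr_0 repr_add in blast)+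
  then show False using repr_below_supp lead_in_supp[OF assms(2)] mon_less_irrefl unfolding t_def by blast
qed

text \<open>Division with remainder.  The leading monomial of \<open>U\<close> is irreducible.  So if it is a
multiple of that of some \<open>g\<close>, the corresponding multiple of \<open>g\<close> really has this leading monomial
and, suitably scaled, can be subtracted to cancel it.\<close>

lemma normal_form_vector_exists:
  "\<exists>R. repr_within (upto_mon (lead U)) (U - R) \<and> (\<not> R \<doteq> 0 \<longrightarrow> lead R \<notin> lead_multiples)"
  if "\<not> U \<doteq> 0"
  using that
proof (induction "lead U" arbitrary: U rule: wf_induct_rule[OF wf_rE])
  case (1 U)
  show ?case
  proof (cases "lead U \<in> lead_multiples")
    case False
    then show ?thesis using repr_0 by (intro exI[of _ U]) simp
  next
    case True
    define t where "t = lead U"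
    have tU: "t \<in> supp U" unfolding t_def using lead_in_supp[OF 1(2)] .
    then have tE: "snd t \<in> E" by (simp add: supp_iff)
    obtain g \<gamma> where g: "g \<in> G" "\<not> V g \<doteq> 0" "t = shift \<gamma> (lead (V g))"
      using True unfolding lead_multiples_def t_def by blast
    obtain \<alpha> e where \<alpha>: "lead (V g) = (\<alpha>, e)" by (cases "lead (V g)")
    define W where "W = Poly_Mapping.single (std_word \<gamma>) 1 \<cdot> V g"
    have W: "repr_within (upto_mon t) W"
      unfolding W_def using g(1,3) mon_le_refl[OF tE] by (intro repr_generator) (auto split: if_splits)
    have "t = (\<alpha> + \<gamma>, e)" using g(3) \<alpha> by simp
    then have "t \<in> supp W"
      using lead_left_mult[OF g(2) \<alpha>, of "std_word \<gamma>"] supp_irreducible tU unfolding W_def by simp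
    then have cW: "coef t W \<noteq> 0" by (simp add: supp_iff)
    define k where "k = coef t U / coef t W"
    define U' where "U' = U - Poly_Mapping.single [] k \<cdot> W"
    have "coef t U' = 0" using cW by (simp add: U'_def coef_diff[OF tE] coef_scale[OF tE] k_def)
    then have "t \<notin> supp U'" by (simp add: supp_iff)
    moreover have "supp U' \<subseteq> upto_mon t"
      unfolding U'_def using supp_diff supp_scale repr_upto_supp[OF W] supp_le_lead t_def by blast
    ultimately have U'_below: "supp U' \<subseteq> below_mon t" by auto
    have kW: "repr_within (upto_mon t) (Poly_Mapping.single [] k \<cdot> W)" using W by (rule repr_scale)
    show ?thesis
    proof (cases "U' \<doteq> 0")
      case True
      then have "U - 0 \<doteq> Poly_Mapping.single [] k \<cdot> W"
        using vcongr_add[OF True vcongr_refl, of "Poly_Mapping.single [] k \<cdot> W"] by (simp add: U'_def)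
      then show ?thesis using repr_cong[OF kW] unfolding t_def by (intro exI[of _ 0]) simp
    next
      case False
      then have less: "lead U' \<prec> t" using lead_in_supp U'_below by blast
      then obtain R where R: "repr_within (upto_mon (lead U')) (U' - R)"
        "\<not> R \<doteq> 0 \<longrightarrow> lead R \<notin> lead_multiples"
        using 1(1)[of U'] False unfolding t_def by blast
      have "repr_within (upto_mon t) (U' - R)" using R(1) less mon_le_trans by (blast intro: repr_mono)
      from repr_add[OF this kW] have "repr_within (upto_mon t) (U - R)" by (simp add: U'_def)
      then show ?thesis using R(2) unfolding t_def by blast
    qed
  qed
qed

end

section \<open>Cosets and the free module\<close>

lemma ring_free_algebra: "ring (free_algebra :: ('n, 'k::field) fpoly ring)"
proof (rule ringI)
  show "abelian_group (free_algebra :: ('n, 'k) fpoly ring)"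
  proof (rule abelian_groupI)
    fix x :: "('n, 'k) fpoly"
    show "\<exists>y\<in>carrier free_algebra. y \<oplus>\<^bsub>free_algebra\<^esub> x = \<zero>\<^bsub>free_algebra\<^esub>"
      by (rule bexI[of _ "- x"]) (simp_all add: free_algebra_def)
  qed (simp_all add: free_algebra_def add_ac)
  show "Group.monoid (free_algebra :: ('n, 'k) fpoly ring)"
    by (rule monoidI) (simp_all add: free_algebra_def mult.assoc)
qed (simp_all add: free_algebra_def distrib_left distrib_right)

lemma two_sided_ideal_of_ideal:
  assumes "ideal J free_algebra" shows "two_sided_ideal J"
proof -
  interpret ideal J free_algebra by fact
  show ?thesis
  proof
    show "0 \<in> J" using additive_subgroup.zero_closed[OF is_additive_subgroup] by (simp add: free_algebra_def)
    show "f + g \<in> J" if "f \<in> J" "g \<in> J" for f g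
      using additive_subgroup.a_closed[OF is_additive_subgroup that] by (simp add: free_algebra_def)
    show "h * f \<in> J" if "f \<in> J" for f h
      using I_l_closed[OF that, of h] by (simp add: free_algebra_def)
    show "f * h \<in> J" if "f \<in> J" for f h
      using I_r_closed[OF that, of h] by (simp add: free_algebra_def)
  qed
qed

lemma ideal_PBW_ideal: "ideal (PBW_ideal S I) free_algebra"
  unfolding PBW_ideal_def by (rule ring.genideal_ideal[OF ring_free_algebra]) (simp add: free_algebra_def)

lemma relations_in_PBW_ideal: "S \<subseteq> PBW_ideal S I"
  unfolding PBW_ideal_def
  using ring.genideal_self[OF ring_free_algebra, of "I \<union> S"] by (simp add: free_algebra_def)

lemma PBW_normal_form:
  assumes "PBW_datum S I r" "wf (r - Id)"
  shows "pbw_normal_form (PBW_ideal S I) r (L_set r I)"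
proof -
  have sys: "commutation_system S r" using assms(1) by (simp add: PBW_datum_def)
  have J: "two_sided_ideal (PBW_ideal S I)" using two_sided_ideal_of_ideal ideal_PBW_ideal by blast
  interpret two_sided_ideal "PBW_ideal S I" by fact
  show ?thesis
  proof
    show "monomial_ordering r" using sys by (simp add: commutation_system_def)
    show "L_set r I = l_set r (PBW_ideal S I \<inter> std_polys)" using assms(1) by (simp add: PBW_datum_def)
  qed (use assms(2) commutation_system_word[OF sys J relations_in_PBW_ideal] in auto)
qed

text \<open>In the rest of the development \<open>J\<close> is the zero element of \<open>A\<close>, which as a coset is the
ideal itself.  It is therefore the same set for all presentations of \<open>A\<close>.\<close>

locale pbw_presentation =
  fixes A :: "('n::{finite,linorder}, 'k::field) fpoly set ring"
    and E :: "'e set"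
    and rE :: "('n expo \<times> 'e) rel"
    and S I :: "'e \<Rightarrow> ('n, 'k) fpoly set"
    and r :: "'e \<Rightarrow> 'n expo rel"
  assumes algebra: "PBW_reduction_algebra A"
    and finite_comps: "finite E"
    and presentation: "PBW_module A E rE S I r"
begin

abbreviation zero_ideal :: "('n, 'k) fpoly set" where "zero_ideal \<equiv> \<zero>\<^bsub>A\<^esub>"

text \<open>For empty \<open>E\<close> the component data say nothing about \<open>A\<close>, so the ideal has to come from \<open>A\<close>
being a PBW-reduction-algebra.\<close>

lemma A_eq: "ideal zero_ideal free_algebra" "A = free_algebra Quot zero_ideal"
proof -
  obtain S I r where SI: "PBW_datum S I r" "A = PBW_quotient S I"
    using algebra unfolding PBW_reduction_algebra_def by blast
  then have "zero_ideal = PBW_ideal S I" by (simp add: PBW_quotient_def FactRing_def)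
  then show "ideal zero_ideal free_algebra" "A = free_algebra Quot zero_ideal"
    using ideal_PBW_ideal SI(2) unfolding PBW_quotient_def by metis+
qed

sublocale quotient: ideal zero_ideal free_algebra
  by (rule A_eq(1))

sublocale two_sided_ideal zero_ideal
  by (rule two_sided_ideal_of_ideal) (rule A_eq(1))

lemma component_datum:
  assumes "e \<in> E"
  shows "PBW_datum (S e) (I e) (induced_ordering rE e)" "zero_ideal = PBW_ideal (S e) (I e)"
proof -
  have "PBW_datum (S e) (I e) (r e)" "A = PBW_quotient (S e) (I e)" "induced_ordering rE e = r e"
    using presentation assms unfolding PBW_module_def by blast+
  then show "PBW_datum (S e) (I e) (induced_ordering rE e)" "zero_ideal = PBW_ideal (S e) (I e)"
    by (simp_all add: PBW_quotient_def FactRing_def)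
qed

sublocale pbw_free_module zero_ideal E rE "\<lambda>e. L_set (induced_ordering rE e) (I e)"
proof (intro pbw_free_module.intro pbw_free_module_axioms.intro)
  show "two_sided_ideal zero_ideal" by (rule two_sided_ideal_axioms)
  show mon: "module_monomial_ordering E rE" using presentation by (simp add: PBW_module_def)
  show wf: "wf (rE - Id)"
  proof (rule wf_module_ordering[OF finite_comps mon])
    fix e \<alpha> assume "e \<in> E"
    then show "((0, e), (\<alpha>, e)) \<in> rE"
      using component_datum(1)[of e] by (auto simp: PBW_datum_def well_ordering_def induced_ordering_def)
  qed
  show "pbw_normal_form zero_ideal (induced_ordering rE e) (L_set (induced_ordering rE e) (I e))" if "e \<in> E" for e
  proof -
    have "induced_ordering rE e - Id \<subseteq> inv_image (rE - Id) (\<lambda>\<alpha>. (\<alpha>, e))"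
      by (auto simp: induced_ordering_def)
    then have "wf (induced_ordering rE e - Id)" using wf_inv_image[OF wf] wf_subset by blast
    then show ?thesis using PBW_normal_form component_datum[OF that] by metis
  qed
  show "\<alpha> + \<gamma> \<in> L_set (induced_ordering rE e) (I e)"
    if "e \<in> E" and \<alpha>: "\<alpha> \<in> L_set (induced_ordering rE e) (I e)" for e \<alpha> \<gamma>
  proof -
    obtain \<beta> \<delta> where "\<beta> \<in> l_set (induced_ordering rE e) (I e)" "\<alpha> = \<beta> + \<delta>"
      using \<alpha> unfolding L_set_def by blast
    moreover have "\<beta> + \<delta> + \<gamma> = \<beta> + (\<delta> + \<gamma>)" by (rule add.assoc)
    ultimately show ?thesis unfolding L_set_def by blast
  qed
  show "finite E" by (rule finite_comps)
qed

notation congr (infix "\<approx>" 50) and vcongr (infix "\<doteq>" 50) and le_mon (infix "\<preceq>" 50) and less_mon (infix "\<prec>" 50)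

lemma mem_cls_iff: "t \<in> cls A f \<longleftrightarrow> f \<approx> t"
proof -
  have "t \<in> cls A f \<longleftrightarrow> (\<exists>h\<in>zero_ideal. t = h + f)"
    by (simp add: cls_def a_r_coset_def' free_algebra_def)
  also have "\<dots> \<longleftrightarrow> t - f \<in> zero_ideal" by (metis add_diff_cancel diff_add_cancel)
  finally show ?thesis using congr_sym unfolding congr_def by blast
qed

lemma cls_eq_iff: "cls A f = cls A g \<longleftrightarrow> f \<approx> g"
proof
  assume "cls A f = cls A g"
  then show "f \<approx> g" using mem_cls_iff congr_refl by blast
next
  assume "f \<approx> g"
  then show "cls A f = cls A g" using mem_cls_iff congr_trans congr_sym by blast
qed

lemma carrier_A: "carrier A = range (cls A)"
  by (subst A_eq(2)) (auto simp: FactRing_def A_RCOSETS_def' cls_def free_algebra_def)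

lemma zero_A: "zero_ideal = cls A 0"
proof (rule Set.set_eqI)
  fix f
  show "f \<in> zero_ideal \<longleftrightarrow> f \<in> cls A 0"
    using mem_cls_iff[of f 0] congr_0_iff[of f] congr_sym by blast
qed

lemma cls_add: "cls A f \<oplus>\<^bsub>A\<^esub> cls A g = cls A (f + g)"
proof -
  have "set_add free_algebra (cls A f) (cls A g) = cls A (f + g)"
    using quotient.a_rcos_sum[of f g] by (simp add: cls_def free_algebra_def)
  then show ?thesis by (subst A_eq(2)) (simp add: FactRing_def)
qed

lemma cls_mult: "cls A f \<otimes>\<^bsub>A\<^esub> cls A g = cls A (f * g)"
proof -
  have "rcoset_mult free_algebra zero_ideal (cls A f) (cls A g) = cls A (f * g)"
    using quotient.rcoset_mult_add[of f g] by (simp add: cls_def free_algebra_def)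
  then show ?thesis by (subst A_eq(2)) (simp add: FactRing_def)
qed

abbreviation M :: "(('n, 'k) fpoly set, 'e \<Rightarrow> ('n, 'k) fpoly set) module" where "M \<equiv> free_module A E"

text \<open>The vector of cosets of a vector of polynomials, extended by \<open>undefined\<close> outside of \<open>E\<close> as the
carrier of the free module demands.\<close>

definition vec :: "('e \<Rightarrow> ('n, 'k) fpoly) \<Rightarrow> 'e \<Rightarrow> ('n, 'k) fpoly set" where
  "vec U = (\<lambda>e\<in>E. cls A (U e))"

lemma vec_eq_iff: "vec U = vec W \<longleftrightarrow> U \<doteq> W"
proof
  assume eq: "vec U = vec W"
  show "U \<doteq> W"
    unfolding vcongr_def
  proof
    fix e assume "e \<in> E"
    then show "U e \<approx> W e" using fun_cong[OF eq, of e] by (simp add: vec_def cls_eq_iff)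
  qed
next
  assume "U \<doteq> W"
  then show "vec U = vec W" unfolding vec_def vcongr_def cls_eq_iff[symmetric] by (auto simp: fun_eq_iff)
qed

lemma zero_M: "\<zero>\<^bsub>M\<^esub> = vec 0"
  by (simp add: free_module_def vec_def zero_A cong: restrict_cong)

lemma vec_eq_0_iff: "vec U = \<zero>\<^bsub>M\<^esub> \<longleftrightarrow> U \<doteq> 0"
  by (simp only: zero_M vec_eq_iff)

lemma add_M: "vec U \<oplus>\<^bsub>M\<^esub> vec W = vec (U + W)"
  by (auto simp: free_module_def vec_def cls_add fun_eq_iff)

lemma smult_M: "cls A h \<odot>\<^bsub>M\<^esub> vec U = vec (h \<cdot> U)"
  by (auto simp: free_module_def vec_def cls_mult left_mult_def fun_eq_iff)

lemma carrier_M: "carrier M = range vec"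
proof
  show "range vec \<subseteq> carrier M"
    by (auto simp: free_module_def vec_def carrier_A)
  show "carrier M \<subseteq> range vec"
  proof
    fix u assume "u \<in> carrier M"
    then have u: "u \<in> E \<rightarrow>\<^sub>E range (cls A)" by (simp add: free_module_def carrier_A)
    then have "\<forall>e\<in>E. \<exists>f. u e = cls A f" by (auto simp: PiE_def Pi_def)
    then obtain U where "\<forall>e\<in>E. u e = cls A (U e)" by metis
    then have "u = vec U" using u by (auto simp: vec_def PiE_def extensional_def fun_eq_iff)
    then show "u \<in> range vec" by blast
  qed
qed

lemma abelian_group_M: "abelian_group M"
proof (rule abelian_groupI)
  fix x assume "x \<in> carrier M"
  then obtain U where "x = vec U" unfolding carrier_M by blast
  then have "vec (- U) \<oplus>\<^bsub>M\<^esub> x = \<zero>\<^bsub>M\<^esub>" by (simp only: add_M zero_M left_minus)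
  then show "\<exists>y\<in>carrier M. y \<oplus>\<^bsub>M\<^esub> x = \<zero>\<^bsub>M\<^esub>" unfolding carrier_M by blast
qed (auto simp only: carrier_M add_M zero_M add_ac add_0_left add_0_right)

sublocale M: abelian_group M
  by (rule abelian_group_M)

lemma uminus_M: "\<ominus>\<^bsub>M\<^esub> vec U = vec (- U)"
  by (rule M.minus_equality) (simp_all only: carrier_M add_M zero_M left_minus rangeI)

lemma minus_M: "vec U \<ominus>\<^bsub>M\<^esub> vec W = vec (U - W)"
  by (simp only: M.minus_eq uminus_M add_M diff_conv_add_uminus)

lemma finsum_M: "finite B \<Longrightarrow> (\<Oplus>\<^bsub>M\<^esub>g\<in>B. vec (F g)) = vec (\<Sum>g\<in>B. F g)"
proof (induction B rule: finite_induct)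
  case empty
  show ?case by (simp only: M.finsum_empty sum.empty zero_M)
next
  case (insert g B)
  have "(\<Oplus>\<^bsub>M\<^esub>g\<in>insert g B. vec (F g)) = vec (F g) \<oplus>\<^bsub>M\<^esub> (\<Oplus>\<^bsub>M\<^esub>g\<in>B. vec (F g))"
    using insert(1,2) by (intro M.finsum_insert) (auto simp: carrier_M)
  then show ?case using insert by (simp only: add_M sum.insert not_False_eq_True)
qed

lemma mono_mult_vec: "mono_mult A E \<gamma> (vec U) = vec (Poly_Mapping.single (std_word \<gamma>) 1 \<cdot> U)"
  by (simp add: mono_mult_def smult_M)

lemma scalar_mult_vec: "scalar_mult A E k (vec U) = vec (Poly_Mapping.single [] k \<cdot> U)"
  by (simp add: scalar_mult_def smult_M)

lemma rep_alg_cls: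
  assumes "e \<in> E"
  shows "rep_alg (induced_ordering rE e) (I e) (cls A f) =
    pbw_normal_form.nf zero_ideal (L_set (induced_ordering rE e) (I e)) f"
proof -
  interpret P: pbw_normal_form zero_ideal "induced_ordering rE e" "L_set (induced_ordering rE e) (I e)"
    using component[OF assms] .
  show ?thesis unfolding rep_alg_def P.nf_def P.irreducibles_iff mem_cls_iff by (simp add: conj_assoc)
qed

lemma rep_vec: "e \<in> E \<Longrightarrow> rep E rE I (vec U) e = nfv U e"
  by (simp add: rep_def vec_def rep_alg_cls nfv_def)

lemma vec_rep: "u \<in> carrier M \<Longrightarrow> vec (rep E rE I u) = u"
proof -
  assume "u \<in> carrier M"
  then obtain U where u: "u = vec U" unfolding carrier_M by blast
  have "rep E rE I u \<doteq> U"
    unfolding vcongr_def u using rep_vec nfv_congr[of U] congr_sym by (simp add: vcongr_def)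
  then show ?thesis using u vec_eq_iff by blast
qed

lemma lec_vec: "lec E rE I (vec U) = lead U"
proof -
  have "{(\<alpha>, e). e \<in> E \<and> \<alpha> \<in> expos (rep E rE I (vec U) e)} = supp U"
    by (auto simp: supp_def rep_vec)
  then show ?thesis by (simp add: lec_def lead_def)
qed

lemma lc_vec: "\<not> U \<doteq> 0 \<Longrightarrow> lc E rE I (vec U) = coef (lead U) U"
  using lead_in_supp[of U] by (simp add: lc_def lcomp_def le_def lec_vec coef_def rep_vec supp_iff)

lemma shift_le_left: "(\<gamma>, \<delta>) \<in> induced_ordering rE (snd s) \<Longrightarrow> snd s \<in> E \<Longrightarrow> shift \<gamma> s \<preceq> shift \<delta> s"
  using shift_less_left[of \<gamma> \<delta> s] mon_le_refl[of "shift \<gamma> s"] by (cases "\<gamma> = \<delta>") auto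

end

section \<open>Standard representations and s-polynomials in the free module\<close>

locale pbw_module_generators = pbw_presentation A E rE S I r
  for A :: "('n::{finite,linorder}, 'k::field) fpoly set ring"
    and E :: "'e set"
    and rE :: "('n expo \<times> 'e) rel"
    and S I :: "'e \<Rightarrow> ('n, 'k) fpoly set"
    and r :: "'e \<Rightarrow> 'n expo rel" +
  fixes G :: "('e \<Rightarrow> ('n, 'k) fpoly set) set"
  assumes finite_gens: "finite G" and gens_in: "G \<subseteq> carrier (free_module A E)"
begin

abbreviation gen :: "('e \<Rightarrow> ('n, 'k) fpoly set) \<Rightarrow> 'e \<Rightarrow> ('n, 'k) fpoly" where
  "gen \<equiv> rep E rE I"

sublocale pbw_generators zero_ideal E rE "\<lambda>e. L_set (induced_ordering rE e) (I e)" G gen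
  by unfold_locales (rule finite_gens)

lemma vec_gen: "g \<in> G \<Longrightarrow> vec (gen g) = g"
  using vec_rep gens_in by blast

lemma gen_eq_0_iff: "g \<in> G \<Longrightarrow> gen g \<doteq> 0 \<longleftrightarrow> g = \<zero>\<^bsub>M\<^esub>"
  using vec_eq_0_iff[of "gen g"] vec_gen by simp

lemma lec_gen: "g \<in> G \<Longrightarrow> lec E rE I g = lead (gen g)"
  using lec_vec[of "gen g"] vec_gen by simp

lemma snd_lead: "\<not> U \<doteq> 0 \<Longrightarrow> snd (lead U) \<in> E"
  using lead_in_supp[of U] by (simp add: supp_iff)

lemma finsum_gens:
  assumes "\<And>g. g \<in> G \<Longrightarrow> a g = cls A (H g)"
  shows "(\<Oplus>\<^bsub>M\<^esub>g\<in>G. a g \<odot>\<^bsub>M\<^esub> g) = vec (\<Sum>g\<in>G. H g \<cdot> gen g)"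
proof -
  have "(\<Oplus>\<^bsub>M\<^esub>g\<in>G. a g \<odot>\<^bsub>M\<^esub> g) = (\<Oplus>\<^bsub>M\<^esub>g\<in>G. vec (H g \<cdot> gen g))"
  proof (rule M.finsum_cong')
    fix g assume "g \<in> G"
    then show "a g \<odot>\<^bsub>M\<^esub> g = vec (H g \<cdot> gen g)" using assms smult_M vec_gen by metis
  qed (auto simp: carrier_M)
  then show ?thesis using finsum_M[OF finite_gens] by simp
qed

text \<open>From left to right, the coefficients are replaced by their normal forms in the component
of the leading monomial of the respective generator: the leading exponent of a normal form bounds
all its words.  From right to left, taking normal forms does not increase the bound.\<close>

lemma standard_representation_iff:
  assumes U: "\<not> U \<doteq> 0"
  shows "(\<exists>a\<in>G \<rightarrow> carrier A. vec W = (\<Oplus>\<^bsub>M\<^esub>g\<in>G. a g \<odot>\<^bsub>M\<^esub> g) \<and>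
            (\<forall>g\<in>G. lec_bounded A E rE I (a g) g (vec U))) \<longleftrightarrow>
         repr_within (upto_mon (lead U)) W"
proof
  assume "\<exists>a\<in>G \<rightarrow> carrier A. vec W = (\<Oplus>\<^bsub>M\<^esub>g\<in>G. a g \<odot>\<^bsub>M\<^esub> g) \<and>
            (\<forall>g\<in>G. lec_bounded A E rE I (a g) g (vec U))"
  then obtain a where a: "a \<in> G \<rightarrow> carrier A" "vec W = (\<Oplus>\<^bsub>M\<^esub>g\<in>G. a g \<odot>\<^bsub>M\<^esub> g)"
    and bd: "\<And>g. g \<in> G \<Longrightarrow> lec_bounded A E rE I (a g) g (vec U)" by blast
  have "\<exists>h. a g = cls A h \<and> (\<not> gen g \<doteq> 0 \<longrightarrow>
      (\<forall>w\<in>Poly_Mapping.keys h. shift (content w) (lead (gen g)) \<preceq> lead U))" if g: "g \<in> G" for g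
  proof -
    have "a g \<in> range (cls A)" using a(1) g carrier_A by blast
    then obtain f where f: "a g = cls A f" by blast
    show ?thesis
    proof (cases "gen g \<doteq> 0")
      case True
      then show ?thesis using f by blast
    next
      case nonzero: False
      define e where "e = snd (lead (gen g))"
      have e: "e \<in> E" using snd_lead[OF nonzero] by (simp add: e_def)
      interpret P: pbw_normal_form zero_ideal "induced_ordering rE e" "L_set (induced_ordering rE e) (I e)"
        using component[OF e] .
      define h where "h = P.nf f"
      have h: "a g = cls A h" using f P.nf_props(2)[of f] by (simp add: cls_eq_iff h_def)
      have "shift (content w) (lead (gen g)) \<preceq> lead U" if w: "w \<in> Poly_Mapping.keys h" for w
      proof -
        have hne: "h \<noteq> 0" using w by auto
        then have "\<not> f \<approx> 0" using P.nf_eq_0_iff[of f] congr_0_iff[of f] by (simp add: h_def)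
        then have ane: "a g \<noteq> \<zero>\<^bsub>A\<^esub>" using f by (simp add: zero_A cls_eq_iff)
        have alg: "rep_alg (induced_ordering rE e) (I e) (a g) = h"
          unfolding f rep_alg_cls[OF e] h_def ..
        have "g \<noteq> \<zero>\<^bsub>M\<^esub>" using nonzero gen_eq_0_iff[OF g] by simp
        with bd[OF g] ane have "shift (le_alg (induced_ordering rE e) (I e) (a g)) (lead (gen g)) \<preceq> lead U"
          unfolding lec_bounded_def lcomp_def lec_gen[OF g] e_def[symmetric] lec_vec by blast
        then have b: "shift (le_poly (induced_ordering rE e) h) (lead (gen g)) \<preceq> lead U"
          by (simp add: le_alg_def alg)
        have "h \<in> std_polys" using P.nf_props(1)[of f] P.irreducibles_iff by (simp add: h_def)
        then have "(content w, le_poly (induced_ordering rE e) h) \<in> induced_ordering rE e"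
          using P.le_poly_in_expos(2) hne P.keys_nf w unfolding h_def by blast
        then have "shift (content w) (lead (gen g)) \<preceq> shift (le_poly (induced_ordering rE e) h) (lead (gen g))"
          using shift_le_left e unfolding e_def by blast
        then show ?thesis using b mon_le_trans by blast
      qed
      then show ?thesis using h by blast
    qed
  qed
  then have "\<forall>g\<in>G. \<exists>h. a g = cls A h \<and> (\<not> gen g \<doteq> 0 \<longrightarrow>
      (\<forall>w\<in>Poly_Mapping.keys h. shift (content w) (lead (gen g)) \<preceq> lead U))" by (rule ballI)
  from bchoice[OF this] obtain H where HH: "\<forall>g\<in>G. a g = cls A (H g) \<and> (\<not> gen g \<doteq> 0 \<longrightarrow>
      (\<forall>w\<in>Poly_Mapping.keys (H g). shift (content w) (lead (gen g)) \<preceq> lead U))" by (elim exE)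
  then have H: "\<And>g. g \<in> G \<Longrightarrow> a g = cls A (H g)" by blast
  have "vec W = vec (\<Sum>g\<in>G. H g \<cdot> gen g)" using a(2) finsum_gens[OF H] by simp
  then have "W \<doteq> (\<Sum>g\<in>G. H g \<cdot> gen g)" by (simp only: vec_eq_iff)
  then show "repr_within (upto_mon (lead U)) W"
    unfolding repr_within_def using HH by (intro exI[of _ H]) simp
next
  assume "repr_within (upto_mon (lead U)) W"
  then obtain H where W: "W \<doteq> (\<Sum>g\<in>G. H g \<cdot> gen g)"
    and H: "\<And>g w. \<lbrakk>g \<in> G; \<not> gen g \<doteq> 0; w \<in> Poly_Mapping.keys (H g)\<rbrakk> \<Longrightarrow> shift (content w) (lead (gen g)) \<preceq> lead U"
    unfolding repr_within_def by blast
  define a where "a = (\<lambda>g. cls A (H g))"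
  have "vec W = (\<Oplus>\<^bsub>M\<^esub>g\<in>G. a g \<odot>\<^bsub>M\<^esub> g)"
    using W finsum_gens[of a H] by (simp add: a_def vec_eq_iff)
  moreover have "a \<in> G \<rightarrow> carrier A" by (simp add: a_def carrier_A)
  moreover have "lec_bounded A E rE I (a g) g (vec U)" if g: "g \<in> G" for g
  proof (cases "a g = \<zero>\<^bsub>A\<^esub> \<or> gen g \<doteq> 0")
    case True
    then show ?thesis using gen_eq_0_iff[OF g] unfolding lec_bounded_def by blast
  next
    case False
    define e where "e = snd (lead (gen g))"
    have e: "e \<in> E" using snd_lead False by (simp add: e_def)
    interpret P: pbw_normal_form zero_ideal "induced_ordering rE e" "L_set (induced_ordering rE e) (I e)"
      using component[OF e] .
    have "a g \<noteq> cls A 0" using False unfolding zero_A[symmetric] by blast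
    then have "\<not> H g \<approx> 0" unfolding a_def cls_eq_iff .
    then have ne: "P.nf (H g) \<noteq> 0" using P.nf_eq_0_iff[of "H g"] congr_0_iff[of "H g"] by blast
    have "P.nf (H g) \<in> std_polys" using P.nf_props(1) P.irreducibles_iff by blast
    from P.le_poly_in_expos(1)[OF this ne] obtain v where v: "v \<in> Poly_Mapping.keys (H g)"
      "(le_poly (induced_ordering rE e) (P.nf (H g)), content v) \<in> induced_ordering rE e"
      using P.expos_nf_bound by blast
    have "shift (le_poly (induced_ordering rE e) (P.nf (H g))) (lead (gen g)) \<preceq> shift (content v) (lead (gen g))"
      using shift_le_left v(2) e unfolding e_def by blast
    then have "shift (le_poly (induced_ordering rE e) (P.nf (H g))) (lead (gen g)) \<preceq> lead U"
      using H[OF g _ v(1)] False mon_le_trans by blast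
    moreover have "le_alg (induced_ordering rE e) (I e) (a g) = le_poly (induced_ordering rE e) (P.nf (H g))"
      by (simp add: le_alg_def a_def rep_alg_cls[OF e])
    ultimately show ?thesis
      using U unfolding lec_bounded_def lcomp_def lec_gen[OF g] e_def[symmetric] lec_vec vec_eq_0_iff by simp
  qed
  ultimately show "\<exists>a\<in>G \<rightarrow> carrier A. vec W = (\<Oplus>\<^bsub>M\<^esub>g\<in>G. a g \<odot>\<^bsub>M\<^esub> g) \<and>
            (\<forall>g\<in>G. lec_bounded A E rE I (a g) g (vec U))" by blast
qed

text \<open>Every monomial of a module element is admitted, so this says that \<open>U\<close> is some left linear
combination of the generators.\<close>

definition generated :: "('e \<Rightarrow> ('n, 'k) fpoly) \<Rightarrow> bool" where
  "generated U \<longleftrightarrow> repr_within (UNIV \<times> E) U"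

lemma generated_left_mult: "generated U \<Longrightarrow> generated (h \<cdot> U)"
  unfolding generated_def by (erule repr_left_mult) (auto simp: shift_def)

lemma generated_gen: "g \<in> G \<Longrightarrow> generated (gen g)"
proof -
  assume g: "g \<in> G"
  show "generated (gen g)"
  proof (cases "gen g \<doteq> 0")
    case True
    then show ?thesis using repr_0 repr_cong unfolding generated_def by blast
  next
    case False
    then have "repr_within (UNIV \<times> E) (Poly_Mapping.single [] 1 \<cdot> gen g)"
      using snd_lead[OF False] g by (intro repr_generator) (auto simp: mem_Times_iff)
    then show ?thesis by (simp add: generated_def)
  qed
qed

lemma submodule_generated: "submodule (vec ` {U. generated U}) A M"
proof (intro submodule.intro subgroup.intro submodule_axioms.intro)
  fix x assume "x \<in> vec ` {U. generated U}"
  then obtain U where U: "x = vec U" "generated U" by blast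
  have "generated (0 - U)" using repr_diff[OF repr_0] U(2) unfolding generated_def by blast
  then have "\<ominus>\<^bsub>M\<^esub> x \<in> vec ` {U. generated U}" unfolding U(1) uminus_M by (simp only: diff_0) blast
  then show "inv\<^bsub>add_monoid M\<^esub> x \<in> vec ` {U. generated U}" by (simp only: a_inv_def)
  fix y assume "y \<in> vec ` {U. generated U}"
  then obtain W where W: "y = vec W" "generated W" by blast
  then show "x \<otimes>\<^bsub>add_monoid M\<^esub> y \<in> vec ` {U. generated U}"
    using repr_add U add_M unfolding generated_def by auto
next
  fix a x assume "a \<in> carrier A" "x \<in> vec ` {U. generated U}"
  then obtain h U where "a = cls A h" "x = vec U" "generated U" unfolding carrier_A by blast
  then show "a \<odot>\<^bsub>M\<^esub> x \<in> vec ` {U. generated U}" using smult_M generated_left_mult by auto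
next
  show "\<one>\<^bsub>add_monoid M\<^esub> \<in> vec ` {U. generated U}"
    using repr_0 zero_M unfolding generated_def by auto
qed (auto simp: carrier_M)

lemma generated_submodule_eq: "generated_submodule A M G = vec ` {U. generated U}"
proof
  have "G \<subseteq> vec ` {U. generated U}" using generated_gen vec_gen by force
  then show "generated_submodule A M G \<subseteq> vec ` {U. generated U}"
    unfolding generated_submodule_def using submodule_generated by blast
  show "vec ` {U. generated U} \<subseteq> generated_submodule A M G"
    unfolding generated_submodule_def
  proof clarify
    fix U N assume "generated U" and N: "submodule N A M" "G \<subseteq> N"
    interpret N: submodule N A M by fact
    show "vec U \<in> N" using \<open>generated U\<close>[unfolded generated_def]
    proof (induction rule: repr_induct)
      case (congr U W)
      then show ?case using vec_eq_iff by metis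
    next
      case zero
      have "\<zero>\<^bsub>M\<^esub> \<in> N" using N.one_closed by simp
      then show ?case unfolding zero_M .
    next
      case (add U W)
      then have "vec U \<oplus>\<^bsub>M\<^esub> vec W \<in> N" using N.m_closed by simp
      then show ?case unfolding add_M .
    next
      case (monomial g w c)
      then have "cls A (Poly_Mapping.single w c) \<odot>\<^bsub>M\<^esub> g \<in> N"
        using N(2) carrier_A by (intro N.smult_closed) auto
      then show ?case using smult_M vec_gen monomial(1) by metis
    qed
  qed
qed

lemma groebner_basis_iff: "groebner_basis A E rE I G (generated_submodule A M G) \<longleftrightarrow> is_groebner"
proof -
  have "G \<subseteq> vec ` {U. generated U}" using generated_gen vec_gen by force
  then have "groebner_basis A E rE I G (generated_submodule A M G) \<longleftrightarrow>
    (\<forall>U. generated U \<longrightarrow> (\<exists>a\<in>G \<rightarrow> carrier A. vec U = (\<Oplus>\<^bsub>M\<^esub>g\<in>G. a g \<odot>\<^bsub>M\<^esub> g) \<and>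
            (\<forall>g\<in>G. lec_bounded A E rE I (a g) g (vec U))))"
    unfolding groebner_basis_def generated_submodule_eq
    using submodule_generated finite_gens by auto
  also have "\<dots> \<longleftrightarrow> is_groebner"
    unfolding is_groebner_def generated_def[symmetric]
  proof (intro iff_allI imp_cong refl)
    fix U
    show "(\<exists>a\<in>G \<rightarrow> carrier A. vec U = (\<Oplus>\<^bsub>M\<^esub>g\<in>G. a g \<odot>\<^bsub>M\<^esub> g) \<and>
            (\<forall>g\<in>G. lec_bounded A E rE I (a g) g (vec U))) \<longleftrightarrow>
        (\<not> U \<doteq> 0 \<longrightarrow> repr_within (upto_mon (lead U)) U)"
    proof (cases "U \<doteq> 0")
      case True
      have "(\<Oplus>\<^bsub>M\<^esub>g\<in>G. \<zero>\<^bsub>A\<^esub> \<odot>\<^bsub>M\<^esub> g) = vec (\<Sum>g\<in>G. 0 \<cdot> gen g)"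
        by (rule finsum_gens) (rule zero_A)
      then have "vec U = (\<Oplus>\<^bsub>M\<^esub>g\<in>G. \<zero>\<^bsub>A\<^esub> \<odot>\<^bsub>M\<^esub> g)"
        using True by (simp only: left_mult_0_left sum.neutral_const vec_eq_iff)
      then show ?thesis
        using True carrier_A zero_A
        by (intro iffI) (auto simp: lec_bounded_def intro!: bexI[of _ "\<lambda>_. \<zero>\<^bsub>A\<^esub>"])
    next
      case False
      then show ?thesis using standard_representation_iff[OF False, of U] by simp
    qed
  qed
  finally show ?thesis .
qed

lemma L_module_eq: "L_module A E rE I G = lead_multiples"
proof -
  have "s = shift \<beta> (lec E rE I g) \<and> g \<in> G \<and> g \<noteq> \<zero>\<^bsub>M\<^esub> \<longleftrightarrow>
      s = shift \<beta> (lead (gen g)) \<and> g \<in> G \<and> \<not> gen g \<doteq> 0" for s \<beta> g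
    by (cases "g \<in> G") (simp_all add: lec_gen gen_eq_0_iff)
  then show ?thesis unfolding L_module_def lead_multiples_def by (simp only:)
qed

text \<open>The bound on the representation is the leading monomial of \<open>U\<close>, which may be larger than
that of \<open>U - R\<close>.\<close>

lemma is_normal_form_vec:
  assumes U: "\<not> U \<doteq> 0"
  shows "is_normal_form A E rE I G (vec U) (vec R) \<longleftrightarrow>
    repr_within (upto_mon (lead U)) (U - R) \<and> (\<not> R \<doteq> 0 \<longrightarrow> lead R \<notin> lead_multiples)"
proof -
  have "vec U = (\<Oplus>\<^bsub>M\<^esub>g\<in>G. h g \<odot>\<^bsub>M\<^esub> g) \<oplus>\<^bsub>M\<^esub> vec R \<longleftrightarrow> vec (U - R) = (\<Oplus>\<^bsub>M\<^esub>g\<in>G. h g \<odot>\<^bsub>M\<^esub> g)"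
    if "h \<in> G \<rightarrow> carrier A" for h
  proof -
    have "\<forall>g\<in>G. \<exists>f. h g = cls A f" using that carrier_A by blast
    then obtain H where H: "\<And>g. g \<in> G \<Longrightarrow> h g = cls A (H g)" by metis
    define X where "X = (\<Sum>g\<in>G. H g \<cdot> gen g)"
    have "U \<doteq> X + R \<longleftrightarrow> U - R \<doteq> X"
      using vcongr_diff[of U "X + R" R R] vcongr_add[of "U - R" X R R] by auto
    then show ?thesis using finsum_gens[of h H, OF H] by (simp add: add_M vec_eq_iff X_def)
  qed
  then have "is_normal_form A E rE I G (vec U) (vec R) \<longleftrightarrow>
      (\<exists>h\<in>G \<rightarrow> carrier A. vec (U - R) = (\<Oplus>\<^bsub>M\<^esub>g\<in>G. h g \<odot>\<^bsub>M\<^esub> g) \<and>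
            (\<forall>g\<in>G. lec_bounded A E rE I (h g) g (vec U))) \<and> (\<not> R \<doteq> 0 \<longrightarrow> lead R \<notin> lead_multiples)"
    unfolding is_normal_form_def L_module_eq lec_vec vec_eq_0_iff using U carrier_M by auto
  then show ?thesis using standard_representation_iff[OF U] by simp
qed

lemma normal_form_exists:
  assumes "u \<in> carrier M" shows "\<exists>f. is_normal_form A E rE I G u f"
proof -
  obtain U where u: "u = vec U" using assms unfolding carrier_M by blast
  show ?thesis
  proof (cases "U \<doteq> 0")
    case True
    then show ?thesis by (auto simp: u is_normal_form_def vec_eq_0_iff)
  next
    case False
    then show ?thesis using normal_form_vector_exists[OF False] is_normal_form_vec[OF False] u by blast
  qed
qed

lemma normal_form_eq_0:
  assumes "is_groebner" "generated U" "is_normal_form A E rE I G (vec U) f"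
  shows "f = \<zero>\<^bsub>M\<^esub>"
proof (cases "U \<doteq> 0")
  case True
  then show ?thesis using assms(3) by (simp add: is_normal_form_def vec_eq_0_iff)
next
  case False
  then have "f \<in> carrier M" using assms(3) by (simp add: is_normal_form_def vec_eq_0_iff)
  then obtain R where f: "f = vec R" unfolding carrier_M by blast
  have nf: "repr_within (upto_mon (lead U)) (U - R)" "\<not> R \<doteq> 0 \<longrightarrow> lead R \<notin> lead_multiples"
    using assms(3) is_normal_form_vec[OF False] unfolding f by blast+
  have "upto_mon (lead U) \<subseteq> UNIV \<times> E" using rE_order(3) by auto
  then have "generated (U - (U - R))"
    using repr_diff[OF _ repr_mono[OF nf(1)]] assms(2) unfolding generated_def by blast
  then have "generated R" by simp
  then have "R \<doteq> 0" using assms(1) nf(2) lead_of_repr unfolding is_groebner_def generated_def by blast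
  then show ?thesis by (simp add: f vec_eq_0_iff)
qed

text \<open>This is how a hypothesis on an s-polynomial enters the criterion: the s-polynomial only has
monomials below \<open>t\<close>, and therefore so does a standard representation of it.\<close>

lemma zero_normal_form_repr:
  assumes "is_normal_form A E rE I G (vec U) \<zero>\<^bsub>M\<^esub>" "supp U \<subseteq> below_mon t"
  shows "repr_within (below_mon t) U"
proof (cases "U \<doteq> 0")
  case True
  then show ?thesis using repr_0 repr_cong by blast
next
  case False
  have "U - 0 = U" by (simp add: fun_eq_iff)
  then have "repr_within (upto_mon (lead U)) U"
    using assms(1) is_normal_form_vec[OF False, of 0] unfolding zero_M by simp
  moreover have "lead U \<prec> t" using assms(2) lead_in_supp[OF False] by blast
  then have "upto_mon (lead U) \<subseteq> below_mon t" using mon_le_less_trans by blast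
  ultimately show ?thesis by (rule repr_mono)
qed

lemma supp_monomial_mult:
  assumes "lead U = (\<alpha>, e)"
  shows "supp (Poly_Mapping.single w c \<cdot> U) \<subseteq> upto_mon (\<alpha> + content w, e)"
proof
  fix s assume "s \<in> supp (Poly_Mapping.single w c \<cdot> U)"
  then have "s \<preceq> shift (content w) (lead U)"
    using supp_left_mult[of s "Poly_Mapping.single w c" U] by (auto split: if_splits)
  then show "s \<in> upto_mon (\<alpha> + content w, e)" by (simp add: assms)
qed

lemma lead_monomial_mult:
  assumes U: "\<not> U \<doteq> 0" "lead U = (\<alpha>, e)" and irr: "\<alpha> + content w \<notin> L_set (induced_ordering rE e) (I e)"
  shows "lead (Poly_Mapping.single w 1 \<cdot> U) = (\<alpha> + content w, e)" "\<not> Poly_Mapping.single w 1 \<cdot> U \<doteq> 0"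
proof -
  have s: "(\<alpha> + content w, e) \<in> supp (Poly_Mapping.single w 1 \<cdot> U)" using lead_left_mult[OF U irr] .
  then show ne: "\<not> Poly_Mapping.single w 1 \<cdot> U \<doteq> 0" using supp_eq_empty_iff by blast
  have "lead (Poly_Mapping.single w 1 \<cdot> U) \<preceq> (\<alpha> + content w, e)"
    using supp_monomial_mult[OF U(2)] lead_in_supp[OF ne] by blast
  then show "lead (Poly_Mapping.single w 1 \<cdot> U) = (\<alpha> + content w, e)"
    using supp_le_lead[OF s] rE_order(2) by (simp add: antisymD)
qed

lemma sup_add_diff: "\<alpha> + (sup \<alpha> \<beta> - \<alpha>) = sup \<alpha> \<beta>" "\<beta> + (sup \<alpha> \<beta> - \<beta>) = sup \<alpha> \<beta>"
  for \<alpha> \<beta> :: "'n expo"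
  by (auto simp: fun_eq_iff sup_nat_def)

text \<open>As \<open>x\<^sup>b(e)\<close> is irreducible for \<open>b = sup \<alpha> \<alpha>'\<close>, it is the leading monomial of both
multiples, and after division by the leading coefficients it cancels.\<close>

lemma spoly_vec:
  assumes g: "g \<in> G" "\<not> gen g \<doteq> 0" "lead (gen g) = (\<alpha>, e)"
    and g': "g' \<in> G" "\<not> gen g' \<doteq> 0" "lead (gen g') = (\<alpha>', e)"
    and irr: "sup \<alpha> \<alpha>' \<notin> L_set (induced_ordering rE e) (I e)"
  shows "\<exists>k k'. k \<noteq> 0 \<and>
    spoly A E rE I g g' = vec (Poly_Mapping.single (std_word (sup \<alpha> \<alpha>' - \<alpha>)) k \<cdot> gen g -
       Poly_Mapping.single (std_word (sup \<alpha> \<alpha>' - \<alpha>')) k' \<cdot> gen g') \<and>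
    supp (Poly_Mapping.single (std_word (sup \<alpha> \<alpha>' - \<alpha>)) k \<cdot> gen g -
       Poly_Mapping.single (std_word (sup \<alpha> \<alpha>' - \<alpha>')) k' \<cdot> gen g') \<subseteq> below_mon (sup \<alpha> \<alpha>', e)"
proof -
  define b where "b = sup \<alpha> \<alpha>'"
  define X where "X = Poly_Mapping.single (std_word (b - \<alpha>)) 1 \<cdot> gen g"
  define X' where "X' = Poly_Mapping.single (std_word (b - \<alpha>')) 1 \<cdot> gen g'"
  have e: "e \<in> E" using snd_lead[OF g(2)] g(3) by simp
  have be: "snd (b, e) \<in> E" using e by simp
  have b: "\<alpha> + (b - \<alpha>) = b" "\<alpha>' + (b - \<alpha>') = b" unfolding b_def by (rule sup_add_diff)+
  have irr': "b \<notin> L_set (induced_ordering rE e) (I e)" using irr by (simp add: b_def)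
  have X: "lead X = (b, e)" "\<not> X \<doteq> 0"
    unfolding X_def using lead_monomial_mult[OF g(2,3), of "std_word (b - \<alpha>)"] irr' b by simp_all
  have X': "lead X' = (b, e)" "\<not> X' \<doteq> 0"
    unfolding X'_def using lead_monomial_mult[OF g'(2,3), of "std_word (b - \<alpha>')"] irr' b by simp_all
  have c: "coef (b, e) X \<noteq> 0" "coef (b, e) X' \<noteq> 0"
    using lead_in_supp X X' by (fastforce simp: supp_iff)+
  define k where "k = 1 / coef (b, e) X"
  define k' where "k' = 1 / coef (b, e) X'"
  \<comment> \<open>the coefficients of \<open>x\<^sup>b(e)\<close> in both summands are \<open>1\<close>\<close>
  define Y where "Y = Poly_Mapping.single [] k \<cdot> X - Poly_Mapping.single [] k' \<cdot> X'"
  have le: "le E rE I g = \<alpha>" "lcomp E rE I g = e" "le E rE I g' = \<alpha>'" "lcomp E rE I g' = e"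
    using lec_gen g g' by (simp_all add: le_def lcomp_def)
  have mm: "mono_mult A E (b - \<alpha>) g = vec X" "mono_mult A E (b - \<alpha>') g' = vec X'"
    using mono_mult_vec vec_gen g(1) g'(1) unfolding X_def X'_def by metis+
  have "spoly A E rE I g g' = vec Y"
    using irr' unfolding spoly_def Let_def le b_def[symmetric] mm lc_vec[OF X(2)] lc_vec[OF X'(2)] X(1) X'(1)
    by (simp only: scalar_mult_vec minus_M Y_def k_def k'_def if_True simp_thms)
  moreover have "Y = Poly_Mapping.single (std_word (b - \<alpha>)) k \<cdot> gen g -
       Poly_Mapping.single (std_word (b - \<alpha>')) k' \<cdot> gen g'"
    by (simp add: Y_def X_def X'_def)
  moreover have "supp Y \<subseteq> below_mon (b, e)"
  proof
    fix s assume s: "s \<in> supp Y"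
    then have "s \<in> supp X \<union> supp X'" unfolding Y_def using supp_diff supp_scale by blast
    then have "s \<preceq> (b, e)" using supp_le_lead X(1) X'(1) by fastforce
    moreover have "coef (b, e) Y = 0"
      using c by (simp only: Y_def coef_diff[OF be] coef_scale[OF be] k_def k'_def) simp
    then have "s \<noteq> (b, e)" using s by (auto simp: supp_iff)
    ultimately show "s \<in> below_mon (b, e)" by simp
  qed
  ultimately show ?thesis using c(1) unfolding b_def[symmetric]
    by (intro exI[of _ k] exI[of _ k']) (simp add: k_def)
qed

lemma spoly_generated:
  assumes "g \<in> G" "g' \<in> G"
  shows "\<exists>U. generated U \<and> spoly A E rE I g g' = vec U"
proof -
  have "\<exists>U. generated U \<and> scalar_mult A E k (mono_mult A E \<gamma> g) = vec U" if "g \<in> G" for g k \<gamma>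
  proof -
    have "scalar_mult A E k (mono_mult A E \<gamma> (vec (gen g))) =
        vec (Poly_Mapping.single [] k \<cdot> Poly_Mapping.single (std_word \<gamma>) 1 \<cdot> gen g)"
      by (simp only: mono_mult_vec scalar_mult_vec)
    then show ?thesis using vec_gen[OF that] generated_left_mult generated_gen[OF that] by metis
  qed
  note scaled = this
  have "\<exists>U. generated U \<and> \<zero>\<^bsub>M\<^esub> = vec U" using zero_M repr_0 unfolding generated_def by blast
  moreover have "\<exists>U. generated U \<and> scalar_mult A E k (mono_mult A E \<gamma> g) \<ominus>\<^bsub>M\<^esub>
      scalar_mult A E k' (mono_mult A E \<gamma>' g') = vec U" for k k' \<gamma> \<gamma>'
  proof -
    obtain U U' where U: "generated U" "scalar_mult A E k (mono_mult A E \<gamma> g) = vec U"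
      and U': "generated U'" "scalar_mult A E k' (mono_mult A E \<gamma>' g') = vec U'"
      using scaled[OF assms(1)] scaled[OF assms(2)] by blast
    have "generated (U - U')" using U(1) U'(1) repr_diff unfolding generated_def by blast
    then show ?thesis unfolding U(2) U'(2) minus_M by blast
  qed
  ultimately show ?thesis unfolding spoly_def Let_def by (simp split: if_splits)
qed

lemma spoly_rel_generated:
  assumes "g \<in> G"
  shows "\<exists>U. generated U \<and> spoly_rel A E rE I g p = vec U"
proof -
  have "\<exists>U. generated U \<and> \<zero>\<^bsub>M\<^esub> = vec U" using zero_M repr_0 unfolding generated_def by blast
  moreover have "\<exists>U. generated U \<and> mono_mult A E \<gamma> g = vec U" for \<gamma>
    using mono_mult_vec[of \<gamma> "gen g"] vec_gen[OF assms] generated_left_mult generated_gen[OF assms] by metis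
  ultimately show ?thesis unfolding spoly_rel_def by simp
qed

text \<open>The s-polynomial of \<open>g\<close> and a relation \<open>p\<close> has no monomial \<open>x\<^sup>b(e)\<close>, where \<open>b\<close> is the least
common multiple of the leading exponents: \<open>b\<close> is a multiple of the leading exponent of \<open>p\<close> and
hence reducible.\<close>

lemma spoly_criterion:
  assumes pairs: "\<And>g g'. \<lbrakk>g \<in> G; g \<noteq> \<zero>\<^bsub>M\<^esub>; g' \<in> G; g' \<noteq> \<zero>\<^bsub>M\<^esub>\<rbrakk> \<Longrightarrow>
      is_normal_form A E rE I G (spoly A E rE I g g') \<zero>\<^bsub>M\<^esub>"
    and relations: "\<And>g p. \<lbrakk>g \<in> G; g \<noteq> \<zero>\<^bsub>M\<^esub>; p \<in> I (lcomp E rE I g)\<rbrakk> \<Longrightarrow>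
      is_normal_form A E rE I G (spoly_rel A E rE I g p) \<zero>\<^bsub>M\<^esub>"
  shows is_groebner
proof (rule buchberger[where ?L0.0 = "\<lambda>e. l_set (induced_ordering rE e) (I e)"])
  fix e
  show "L_set (induced_ordering rE e) (I e) = {\<beta> + \<gamma> | \<beta> \<gamma>. \<beta> \<in> l_set (induced_ordering rE e) (I e)}"
    by (simp add: L_set_def)
next
  fix g g' \<alpha> \<alpha>' e
  assume g: "g \<in> G" "\<not> gen g \<doteq> 0" "g' \<in> G" "\<not> gen g' \<doteq> 0"
    "lead (gen g) = (\<alpha>, e)" "lead (gen g') = (\<alpha>', e)"
    and irr: "sup \<alpha> \<alpha>' \<notin> L_set (induced_ordering rE e) (I e)"
  have nf: "is_normal_form A E rE I G (spoly A E rE I g g') \<zero>\<^bsub>M\<^esub>"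
    using g gen_eq_0_iff by (intro pairs) auto
  show "\<exists>k k'. k \<noteq> 0 \<and> repr_within (below_mon (sup \<alpha> \<alpha>', e))
        (Poly_Mapping.single (std_word (sup \<alpha> \<alpha>' - \<alpha>)) k \<cdot> gen g -
         Poly_Mapping.single (std_word (sup \<alpha> \<alpha>' - \<alpha>')) k' \<cdot> gen g')"
  proof -
    obtain k k' where k: "k \<noteq> 0" and eq: "spoly A E rE I g g' = vec
        (Poly_Mapping.single (std_word (sup \<alpha> \<alpha>' - \<alpha>)) k \<cdot> gen g -
         Poly_Mapping.single (std_word (sup \<alpha> \<alpha>' - \<alpha>')) k' \<cdot> gen g')"
      and below: "supp (Poly_Mapping.single (std_word (sup \<alpha> \<alpha>' - \<alpha>)) k \<cdot> gen g -
         Poly_Mapping.single (std_word (sup \<alpha> \<alpha>' - \<alpha>')) k' \<cdot> gen g') \<subseteq> below_mon (sup \<alpha> \<alpha>', e)"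
      using spoly_vec[OF g(1,2,5) g(3,4,6) irr] by blast
    from zero_normal_form_repr[OF nf[unfolded eq] below] k show ?thesis by blast
  qed
next
  fix g \<alpha> e \<beta>
  assume g: "g \<in> G" "\<not> gen g \<doteq> 0" "lead (gen g) = (\<alpha>, e)" and "\<beta> \<in> l_set (induced_ordering rE e) (I e)"
  then obtain p where p: "p \<in> I e" "p \<noteq> 0" "\<beta> = le_poly (induced_ordering rE e) p"
    unfolding l_set_def by blast
  define X where "X = Poly_Mapping.single (std_word (sup \<alpha> \<beta> - \<alpha>)) 1 \<cdot> gen g"
  have le: "le E rE I g = \<alpha>" "lcomp E rE I g = e"
    using lec_gen g by (simp_all add: le_def lcomp_def)
  have "mono_mult A E (sup \<alpha> \<beta> - \<alpha>) g = vec X"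
    using mono_mult_vec vec_gen[OF g(1)] unfolding X_def by metis
  then have eq: "spoly_rel A E rE I g p = vec X" using p by (simp add: spoly_rel_def le)
  have "is_normal_form A E rE I G (spoly_rel A E rE I g p) \<zero>\<^bsub>M\<^esub>"
    using g gen_eq_0_iff p le by (intro relations) auto
  moreover have "supp X \<subseteq> below_mon (sup \<alpha> \<beta>, e)"
  proof
    fix s assume s: "s \<in> supp X"
    then have "s \<preceq> (\<alpha> + (sup \<alpha> \<beta> - \<alpha>), e)" using supp_monomial_mult[OF g(3)] unfolding X_def by fastforce
    then have "s \<preceq> (sup \<alpha> \<beta>, e)" by (simp only: sup_add_diff)
    moreover have "\<beta> + (sup \<alpha> \<beta> - \<beta>) \<in> L_set (induced_ordering rE e) (I e)"
      using \<open>\<beta> \<in> _\<close> unfolding L_set_def by blast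
    then have "s \<noteq> (sup \<alpha> \<beta>, e)" using s supp_irreducible unfolding sup_add_diff by blast
    ultimately show "s \<in> below_mon (sup \<alpha> \<beta>, e)" by simp
  qed
  ultimately show "repr_within (below_mon (sup \<alpha> \<beta>, e)) (Poly_Mapping.single (std_word (sup \<alpha> \<beta> - \<alpha>)) 1 \<cdot> gen g)"
    unfolding eq X_def[symmetric] by (rule zero_normal_form_repr)
qed

end

theorem proposition1p28:
  fixes A :: "('n::{finite,linorder}, 'k::field) fpoly set ring"
    and E :: "'e set"
    and rE :: "('n expo \<times> 'e) rel"
    and S I :: "'e \<Rightarrow> ('n, 'k) fpoly set"
    and r :: "'e \<Rightarrow> 'n expo rel"
    and G :: "('e \<Rightarrow> ('n, 'k) fpoly set) set"
  assumes "PBW_reduction_algebra A"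
    and "finite E"
    and "PBW_module A E rE S I r"
    and "finite G" and "G \<subseteq> carrier (free_module A E)"
  shows "(groebner_basis A E rE I G (generated_submodule A (free_module A E) G) \<longleftrightarrow>
           (\<forall>g\<in>G - {\<zero>\<^bsub>free_module A E\<^esub>}. \<forall>g'\<in>G - {\<zero>\<^bsub>free_module A E\<^esub>}.
              \<exists>f. is_normal_form A E rE I G (spoly A E rE I g g') f \<and> f = \<zero>\<^bsub>free_module A E\<^esub>) \<and>
           (\<forall>g\<in>G - {\<zero>\<^bsub>free_module A E\<^esub>}. \<forall>p\<in>I (lcomp E rE I g).
              \<exists>f. is_normal_form A E rE I G (spoly_rel A E rE I g p) f \<and> f = \<zero>\<^bsub>free_module A E\<^esub>))
       \<and> (groebner_basis A E rE I G (generated_submodule A (free_module A E) G) \<longleftrightarrow>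
           (\<forall>g\<in>G - {\<zero>\<^bsub>free_module A E\<^esub>}. \<forall>g'\<in>G - {\<zero>\<^bsub>free_module A E\<^esub>}.
              \<forall>f. is_normal_form A E rE I G (spoly A E rE I g g') f \<longrightarrow> f = \<zero>\<^bsub>free_module A E\<^esub>) \<and>
           (\<forall>g\<in>G - {\<zero>\<^bsub>free_module A E\<^esub>}. \<forall>p\<in>I (lcomp E rE I g).
              \<forall>f. is_normal_form A E rE I G (spoly_rel A E rE I g p) f \<longrightarrow> f = \<zero>\<^bsub>free_module A E\<^esub>))"
    (is "(?GB \<longleftrightarrow> ?some) \<and> (?GB \<longleftrightarrow> ?any)")
proof -
  interpret pbw_module_generators A E rE S I r G
    using assms by unfold_locales
  have "?any" if GB: "?GB"
  proof (intro conjI ballI allI impI)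
    fix g g' f assume g: "g \<in> G - {\<zero>\<^bsub>M\<^esub>}" "g' \<in> G - {\<zero>\<^bsub>M\<^esub>}"
      and f: "is_normal_form A E rE I G (spoly A E rE I g g') f"
    obtain U where U: "generated U" "spoly A E rE I g g' = vec U"
      using spoly_generated[of g g'] g by blast
    show "f = \<zero>\<^bsub>M\<^esub>" using normal_form_eq_0[OF GB[unfolded groebner_basis_iff] U(1) f[unfolded U(2)]] .
  next
    fix g p f assume g: "g \<in> G - {\<zero>\<^bsub>M\<^esub>}" and f: "is_normal_form A E rE I G (spoly_rel A E rE I g p) f"
    obtain U where U: "generated U" "spoly_rel A E rE I g p = vec U"
      using spoly_rel_generated[of g p] g by blast
    show "f = \<zero>\<^bsub>M\<^esub>" using normal_form_eq_0[OF GB[unfolded groebner_basis_iff] U(1) f[unfolded U(2)]] .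
  qed
  moreover have "?some" if any: "?any"
  proof -
    have carr: "spoly A E rE I g g' \<in> carrier M" "spoly_rel A E rE I g p \<in> carrier M"
      if "g \<in> G" "g' \<in> G" for g g' p
      using spoly_generated[OF that] spoly_rel_generated[OF that(1), of p] carrier_M by auto
    show ?thesis
    proof (intro conjI ballI)
      fix g g' assume g: "g \<in> G - {\<zero>\<^bsub>M\<^esub>}" "g' \<in> G - {\<zero>\<^bsub>M\<^esub>}"
      then obtain f where f: "is_normal_form A E rE I G (spoly A E rE I g g') f"
        using normal_form_exists[OF carr(1)] by blast
      then show "\<exists>f. is_normal_form A E rE I G (spoly A E rE I g g') f \<and> f = \<zero>\<^bsub>M\<^esub>"
        using conjunct1[OF any, rule_format, OF g f] by blast
    next
      fix g p assume g: "g \<in> G - {\<zero>\<^bsub>M\<^esub>}" "p \<in> I (lcomp E rE I g)"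
      then obtain f where f: "is_normal_form A E rE I G (spoly_rel A E rE I g p) f"
        using normal_form_exists[OF carr(2)] by blast
      then show "\<exists>f. is_normal_form A E rE I G (spoly_rel A E rE I g p) f \<and> f = \<zero>\<^bsub>M\<^esub>"
        using conjunct2[OF any, rule_format, OF g f] by blast
    qed
  qed
  moreover have "?GB" if "?some"
    unfolding groebner_basis_iff using that by (intro spoly_criterion) blast+
  ultimately show ?thesis by blast
qed

end
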